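(* The infinitesimal action of $\mathfrak{so}(1,4)$ induced by the action of ${\rm SO}(1,4)$ on $S^3$ has as image the vector space formed by the vector fields $$X_{(q,z,w)}(x)=\frac{1}{2}(q-x\overline{q}x)+zx+xw,\qquad x\in S^3,$$ where $q\in\mathbb{H}=\mathfrak{s}$ and $z,w\in{\rm Im}\,\mathbb{H}=\mathfrak{su}(2)$. This vector space is a $10$-dimensional Lie algebra isomorphic to $\mathfrak{so}(1,4)$.
   Context: $\mathbb{H}$ denotes the quaternions, ${\rm Im}\,\mathbb{H}$ the purely imaginary quaternions, $\overline{q}$ quaternionic conjugation, and $S^3\subset\mathbb{H}$ the unit quaternions; products in the formula are quaternionic products. The group $G={\rm SO}(1,4)$ (taken connected) consists of real $5\times5$ matrices preserving the form ${\rm diag}(1,-1,-1,-1,-1)$, with Lie algebra $$\mathfrak{so}(1,4)=\left\{\begin{bmatrix}0&\beta\\ \beta^t&\gamma\end{bmatrix} : \beta\in\mathbb{R}^4 \text{ (row vector)},\ \gamma\in\mathfrak{so}(4)\right\}=\mathfrak{k}\oplus\mathfrak{s},$$ where $\mathfrak{k}=\{\beta=0\}=\mathfrak{so}(4)=\mathfrak{su}(2)\oplus\mathfrak{su}(2)$ and $\mathfrak{s}=\{\gamma=0\}$. The space $\mathfrak{s}$ is identified with $\mathbb{H}$ by $\beta=(p,q,r,s)\leftrightarrow p+q\mathbf{i}+r\mathbf{j}+s\mathbf{k}$. Let $K={\rm SO}(4)$ be embedded as ${\rm diag}(1,{\rm SO}(4))$, let $H\in\mathfrak{s}$ be the element with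 $\beta=(1,0,0,0)$, and let $P$ be the minimal parabolic subgroup of $G$ whose Lie algebra is the sum of the eigenspaces of ${\rm ad}(H)$ with nonnegative eigenvalues. The unique flag manifold $G/P=K/(K\cap P)$ is identified with the adjoint orbit ${\rm Ad}(K)H\subset\mathfrak{s}=\mathbb{H}$, via $kP\mapsto{\rm Ad}(k)H$ for $k\in K$, and this orbit is the unit sphere $S^3\subset\mathbb{H}$; the action of $G$ on $S^3$ is the natural action on $G/P$ transported by this identification. The induced infinitesimal action sends $Y\in\mathfrak{so}(1,4)$ to the vector field $\tilde{Y}(x)=\frac{d}{dt}\big|_{t=0}\exp(tY)\cdot x$ on $S^3$. *)

theory Defs
  imports "HOL-Analysis.Analysis" "HOL-Library.Function_Algebras"
begin

section \<open>Quaternions\<close>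

text \<open>The quaternion p + q i + r j + s k is the vector (p, q, r, s).  The library's
  multiplication on \<^typ>\<open>real^4\<close> is componentwise and is never used below.\<close>

type_synonym quat = "real^4"

definition qmul :: "quat \<Rightarrow> quat \<Rightarrow> quat" (infixl "\<odot>" 70) where
  "x \<odot> y = vector
     [x$1 * y$1 - x$2 * y$2 - x$3 * y$3 - x$4 * y$4,
      x$1 * y$2 + x$2 * y$1 + x$3 * y$4 - x$4 * y$3,
      x$1 * y$3 - x$2 * y$4 + x$3 * y$1 + x$4 * y$2,
      x$1 * y$4 + x$2 * y$3 - x$3 * y$2 + x$4 * y$1]"

definition qcnj :: "quat \<Rightarrow> quat" where
  "qcnj x = vector [x$1, - x$2, - x$3, - x$4]"

definition ImH :: "quat set" where
  "ImH = {x. x$1 = 0}"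

abbreviation S3 :: "quat set" where
  "S3 \<equiv> sphere 0 1"


section \<open>The group and its Lie algebra\<close>

type_synonym mat5 = "real^5^5"

text \<open>The block matrix with rows (a, b) and (c, D), where b is a row and c a column.\<close>

definition block_mat :: "real \<Rightarrow> real^4 \<Rightarrow> real^4 \<Rightarrow> real^4^4 \<Rightarrow> mat5" where
  "block_mat a b c D = vector
     [vector [a,    b$1,   b$2,   b$3,   b$4],
      vector [c$1, D$1$1, D$1$2, D$1$3, D$1$4],
      vector [c$2, D$2$1, D$2$2, D$2$3, D$2$4],
      vector [c$3, D$3$1, D$3$2, D$3$3, D$3$4],
      vector [c$4, D$4$1, D$4$2, D$4$3, D$4$4]]"

definition lorentz_form :: mat5 where
  "lorentz_form = block_mat 1 0 0 (- mat 1)"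

text \<open>The group is taken connected: the identity component of the determinant one matrices
  that preserve the form.\<close>

definition G14 :: "mat5 set" where
  "G14 = connected_component_set
     {g. transpose g ** lorentz_form ** g = lorentz_form \<and> det g = 1} (mat 1)"

definition so14 :: "mat5 set" where
  "so14 = {block_mat 0 b b D | b D. transpose D = - D}"

definition K4 :: "mat5 set" where
  "K4 = {block_mat 1 0 0 A | A. rotation_matrix A}"

definition mat_bracket :: "mat5 \<Rightarrow> mat5 \<Rightarrow> mat5" where
  "mat_bracket A B = A ** B - B ** A"

definition Ad :: "mat5 \<Rightarrow> mat5 \<Rightarrow> mat5" where
  "Ad g Y = g ** Y ** matrix_inv g"

text \<open>The library's \<^const>\<open>exp\<close> is not available here: square matrices are not an instance
  of the class of real normed algebras.\<close>

definition mat_exp :: "mat5 \<Rightarrow> mat5" where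
  "mat_exp A = (\<Sum>n. (1 / fact n) *\<^sub>R (((**) A ^^ n) (mat 1)))"


section \<open>The flag manifold and the action on the sphere\<close>

text \<open>The identification of the symmetric part of the Lie algebra with the quaternions,
  reading off the row b.\<close>

definition quat_of_mat :: "mat5 \<Rightarrow> quat" where
  "quat_of_mat Y = vector [Y$1$2, Y$1$3, Y$1$4, Y$1$5]"

definition Hel :: mat5 where
  "Hel = block_mat 0 (vector [1, 0, 0, 0]) (vector [1, 0, 0, 0]) 0"

definition par_alg :: "mat5 set" where
  "par_alg = span (\<Union>l\<in>{0..}. {Y \<in> so14. mat_bracket Hel Y = l *\<^sub>R Y})"

text \<open>The parabolic subgroup with a given parabolic Lie algebra is the normalizer of that
  algebra in the group.\<close>

definition P_min :: "mat5 set" where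
  "P_min = {g \<in> G14. Ad g ` par_alg = par_alg}"

definition coset_P :: "mat5 \<Rightarrow> mat5 set" where
  "coset_P g = (\<lambda>p. g ** p) ` P_min"

definition flag :: "mat5 set set" where
  "flag = coset_P ` G14"

text \<open>The identification of the flag manifold with the sphere, sending the coset of an
  element k of K to Ad(k) H.\<close>

definition flag_to_S3 :: "mat5 set \<Rightarrow> quat" where
  "flag_to_S3 C = (THE x. \<exists>k\<in>K4. C = coset_P k \<and> x = quat_of_mat (Ad k Hel))"

definition act :: "mat5 \<Rightarrow> quat \<Rightarrow> quat" where
  "act g x = flag_to_S3 ((\<lambda>h. g ** h) ` inv_into flag flag_to_S3 x)"


section \<open>Vector fields on the sphere\<close>

text \<open>A vector field on the sphere is represented by a function on the whole space that
  vanishes off the sphere, so that equality of fields is equality of functions.\<close>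

definition on_S3 :: "(quat \<Rightarrow> quat) \<Rightarrow> quat \<Rightarrow> quat" where
  "on_S3 f = (\<lambda>x. if x \<in> S3 then f x else 0)"

definition vf_scale :: "real \<Rightarrow> (quat \<Rightarrow> quat) \<Rightarrow> quat \<Rightarrow> quat" where
  "vf_scale c f = (\<lambda>x. c *\<^sub>R f x)"

global_interpretation vf: vector_space vf_scale
  by unfold_locales
     (auto simp: vf_scale_def plus_fun_def fun_eq_iff scaleR_add_left scaleR_add_right)

text \<open>The differential at a point of the sphere of a field given only on the sphere is taken
  by extending the field radially; on tangent vectors this is the intrinsic differential.\<close>

definition S3_deriv :: "(quat \<Rightarrow> quat) \<Rightarrow> quat \<Rightarrow> quat \<Rightarrow> quat" where
  "S3_deriv V x = frechet_derivative (\<lambda>y. V (y /\<^sub>R norm y)) (at x)"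

definition vf_bracket :: "(quat \<Rightarrow> quat) \<Rightarrow> (quat \<Rightarrow> quat) \<Rightarrow> quat \<Rightarrow> quat" where
  "vf_bracket V W = on_S3 (\<lambda>x. S3_deriv W x (V x) - S3_deriv V x (W x))"

definition inf_action :: "mat5 \<Rightarrow> quat \<Rightarrow> quat" where
  "inf_action Y = on_S3 (\<lambda>x. vector_derivative (\<lambda>t. act (mat_exp (t *\<^sub>R Y)) x) (at 0))"

definition X_field :: "quat \<Rightarrow> quat \<Rightarrow> quat \<Rightarrow> quat \<Rightarrow> quat" where
  "X_field q z w = on_S3 (\<lambda>x. (1/2) *\<^sub>R (q - x \<odot> qcnj q \<odot> x) + z \<odot> x + x \<odot> w)"

definition X_space :: "(quat \<Rightarrow> quat) set" where
  "X_space = {X_field q z w | q z w. z \<in> ImH \<and> w \<in> ImH}"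


section \<open>Lie algebras on a carrier\<close>

locale lie_algebra = vector_space scale
  for scale :: "real \<Rightarrow> 'v::ab_group_add \<Rightarrow> 'v" +
  fixes L :: "'v set" and br :: "'v \<Rightarrow> 'v \<Rightarrow> 'v"
  assumes carrier_subspace: "subspace L"
    and br_closed: "\<lbrakk>x \<in> L; y \<in> L\<rbrakk> \<Longrightarrow> br x y \<in> L"
    and br_add_left: "\<lbrakk>x \<in> L; y \<in> L; z \<in> L\<rbrakk> \<Longrightarrow> br (x + y) z = br x z + br y z"
    and br_add_right: "\<lbrakk>x \<in> L; y \<in> L; z \<in> L\<rbrakk> \<Longrightarrow> br x (y + z) = br x y + br x z"
    and br_scale_left: "\<lbrakk>x \<in> L; y \<in> L\<rbrakk> \<Longrightarrow> br (scale c x) y = scale c (br x y)"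
    and br_scale_right: "\<lbrakk>x \<in> L; y \<in> L\<rbrakk> \<Longrightarrow> br x (scale c y) = scale c (br x y)"
    and br_self: "x \<in> L \<Longrightarrow> br x x = 0"
    and jacobi: "\<lbrakk>x \<in> L; y \<in> L; z \<in> L\<rbrakk> \<Longrightarrow>
      br x (br y z) + br y (br z x) + br z (br x y) = 0"

definition lie_isomorphism ::
  "(real \<Rightarrow> 'v::ab_group_add \<Rightarrow> 'v) \<Rightarrow> 'v set \<Rightarrow> ('v \<Rightarrow> 'v \<Rightarrow> 'v) \<Rightarrow>
   (real \<Rightarrow> 'w::ab_group_add \<Rightarrow> 'w) \<Rightarrow> 'w set \<Rightarrow> ('w \<Rightarrow> 'w \<Rightarrow> 'w) \<Rightarrow>
   ('v \<Rightarrow> 'w) \<Rightarrow> bool" where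
  "lie_isomorphism sc L br sc' L' br' f \<longleftrightarrow>
     bij_betw f L L' \<and>
     (\<forall>x\<in>L. \<forall>y\<in>L. f (x + y) = f x + f y) \<and>
     (\<forall>c. \<forall>x\<in>L. f (sc c x) = sc' c (f x)) \<and>
     (\<forall>x\<in>L. \<forall>y\<in>L. f (br x y) = br' (f x) (f y))"

end

theory Submission
  imports Defs
begin

text \<open>
  The group acts linearly on \<^typ>\<open>real^5\<close>, and hence on the lines of the light cone; a line of the
  cone meets the affine hyperplane of vectors with first coordinate 1 in exactly one vector
  \<^term>\<open>event 1 x\<close>, and then \<^term>\<open>x\<close> lies on the sphere.  The whole proof consists in showing
  that the action on the flag manifold, which is defined through a normalizer, cosets and the
  adjoint orbit of \<^term>\<open>Hel\<close>, is this action on the cone.  Everything after that is explicit.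

  The parabolic algebra consists of the elements of the Lie algebra that have as an eigenvector
  the null vector \<^term>\<open>base_null\<close>, the event over the quaternion one (\<open>par_alg_eq_eigenvector\<close>), because
  \<^term>\<open>base_null\<close> spans the top eigenspace of \<^term>\<open>Hel\<close>.  No other null line is an eigenline of
  the whole algebra, so its normalizer is the stabilizer of that line
  (\<open>P_min_eq_line_stabilizer\<close>) and a coset \<^term>\<open>coset_P g\<close> is determined by the line of
  \<^term>\<open>g *v base_null\<close>.  The element of the coset that lies in \<^term>\<open>K4\<close> is found with left
  multiplication by a unit quaternion, which moves the quaternion one to any given point of the
  sphere.  The result, \<open>act_eq\<close>, says that \<^term>\<open>act g x\<close> is the quotient of the last four
  coordinates of \<^term>\<open>g *v event 1 x\<close> by the first one.

  Differentiating this quotient along the exponential of the block matrix with row and column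
  \<^term>\<open>b\<close> and skew block \<^term>\<open>D\<close> gives the field \<^term>\<open>\<lambda>x. b + D *v x - (b \<bullet> x) *\<^sub>R x\<close>
  (\<open>inf_action_eq_action_field\<close>, \<open>action_field_block\<close>).  On unit quaternions
  \<^term>\<open>x \<odot> qcnj q \<odot> x\<close> equals twice \<^term>\<open>(q \<bullet> x) *\<^sub>R x\<close> minus \<^term>\<open>q\<close>, and the skew
  \<open>4 \<times> 4\<close> matrices are exactly the maps \<open>x \<mapsto> z x + x w\<close> with imaginary \<^term>\<open>z\<close> and
  \<^term>\<open>w\<close>; so these fields are those of \<^term>\<open>X_space\<close>.

  A left action induces an antihomomorphism from the Lie algebra to vector fields
  (\<open>vf_bracket_action_field\<close>).  Composing it with the change of sign gives an injective
  homomorphism with image \<^term>\<open>X_space\<close>, which yields the Lie algebra axioms and the isomorphism.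
  The dimension is that of the parameters \<open>(q, z, w)\<close>, namely 4 + 3 + 3.
\<close>

section \<open>Coordinates and block matrices\<close>

lemma exhaust_5:
  fixes x :: 5
  shows "x = 1 \<or> x = 2 \<or> x = 3 \<or> x = 4 \<or> x = 5"
proof (induct x)
  case (of_int z)
  then have "z = 0 \<or> z = 1 \<or> z = 2 \<or> z = 3 \<or> z = 4" by fastforce
  then show ?case by auto
qed

lemma forall_5: "(\<forall>i::5. P i) \<longleftrightarrow> P 1 \<and> P 2 \<and> P 3 \<and> P 4 \<and> P 5"
  by (metis exhaust_5)

lemma UNIV_5: "UNIV = {1, 2, 3, 4, 5::5}"
  using exhaust_5 by auto

lemma sum_5: "sum f (UNIV::5 set) = f 1 + f 2 + f 3 + f 4 + f 5"
  unfolding UNIV_5 by (simp add: ac_simps)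

lemma vector_4 [simp]:
  "(vector [a,b,c,d] :: ('a::zero)^4)$1 = a"
  "(vector [a,b,c,d] :: ('a::zero)^4)$2 = b"
  "(vector [a,b,c,d] :: ('a::zero)^4)$3 = c"
  "(vector [a,b,c,d] :: ('a::zero)^4)$4 = d"
  unfolding vector_def by simp_all

lemma vector_5 [simp]:
  "(vector [a,b,c,d,e] :: ('a::zero)^5)$1 = a"
  "(vector [a,b,c,d,e] :: ('a::zero)^5)$2 = b"
  "(vector [a,b,c,d,e] :: ('a::zero)^5)$3 = c"
  "(vector [a,b,c,d,e] :: ('a::zero)^5)$4 = d"
  "(vector [a,b,c,d,e] :: ('a::zero)^5)$5 = e"
  unfolding vector_def by simp_all

lemma vec4_eq_iff: "x = y \<longleftrightarrow> x$1 = y$1 \<and> x$2 = y$2 \<and> x$3 = y$3 \<and> x$4 = (y::'a^4)$4"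
  by (simp add: vec_eq_iff forall_4)

lemma vec5_eq_iff:
  "x = y \<longleftrightarrow> x$1 = y$1 \<and> x$2 = y$2 \<and> x$3 = y$3 \<and> x$4 = y$4 \<and> x$5 = (y::'a^5)$5"
  by (simp add: vec_eq_iff forall_5)

lemma inner_4: "x \<bullet> y = x$1 * y$1 + x$2 * y$2 + x$3 * y$3 + x$4 * (y::real^4)$4"
  by (simp add: inner_vec_def sum_4)

text \<open>A vector of \<^typ>\<open>real^5\<close> is treated as an event of Minkowski space, with one time and four
  space coordinates; the space coordinates are read as a quaternion.\<close>

definition event :: "real \<Rightarrow> quat \<Rightarrow> real^5" where
  "event s x = vector [s, x$1, x$2, x$3, x$4]"

definition space_part :: "real^5 \<Rightarrow> quat" where
  "space_part u = vector [u$2, u$3, u$4, u$5]"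

definition outer :: "quat \<Rightarrow> quat \<Rightarrow> real^4^4" where
  "outer c b = (\<chi> i j. c$i * b$j)"

lemma outer_0 [simp]: "outer 0 b = 0" "outer c 0 = 0"
  by (simp_all add: outer_def vec_eq_iff)

lemma event_nth1 [simp]: "event s x $ 1 = s"
  by (simp add: event_def)

lemma space_part_event [simp]: "space_part (event s x) = x"
  by (simp add: event_def space_part_def vec4_eq_iff)

lemma event_space_part [simp]: "event (u$1) (space_part u) = u"
  by (simp add: event_def space_part_def vec5_eq_iff)

lemma event_eq_iff [simp]: "event s x = event t y \<longleftrightarrow> s = t \<and> x = y"
  by (metis event_nth1 space_part_event)

lemma scaleR_event: "c *\<^sub>R event s x = event (c * s) (c *\<^sub>R x)"
  by (simp add: event_def vec5_eq_iff)

lemma linear_space_part: "linear space_part"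
  by (intro linearI) (simp_all add: space_part_def vec4_eq_iff)

lemma block_mat_event:
  "block_mat a b c D *v event s x = event (a * s + b \<bullet> x) (s *\<^sub>R c + D *v x)"
  by (simp add: block_mat_def event_def vec5_eq_iff matrix_vector_mult_def sum_4 sum_5 inner_4)

lemma transpose_block_mat: "transpose (block_mat a b c D) = block_mat a c b (transpose D)"
  by (simp add: block_mat_def vec5_eq_iff transpose_def)

lemma block_mat_mult:
  "block_mat a b c D ** block_mat a' b' c' D' =
   block_mat (a * a' + b \<bullet> c') (a *\<^sub>R b' + b v* D') (a' *\<^sub>R c + D *v c') (outer c b' + D ** D')"
  by (simp add: block_mat_def outer_def vec5_eq_iff matrix_matrix_mult_def matrix_vector_mult_def
      vector_matrix_mult_def sum_4 sum_5 inner_4 algebra_simps)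

lemma block_mat_eq_iff [simp]:
  "block_mat a b c D = block_mat a' b' c' D' \<longleftrightarrow> a = a' \<and> b = b' \<and> c = c' \<and> D = D'"
  by (auto simp: block_mat_def vec5_eq_iff vec4_eq_iff)

lemma block_mat_cases:
  obtains a b c D where "M = block_mat a b c D"
proof
  show "M = block_mat (M$1$1) (vector [M$1$2, M$1$3, M$1$4, M$1$5])
     (vector [M$2$1, M$3$1, M$4$1, M$5$1])
     (vector [vector [M$2$2, M$2$3, M$2$4, M$2$5], vector [M$3$2, M$3$3, M$3$4, M$3$5],
              vector [M$4$2, M$4$3, M$4$4, M$4$5], vector [M$5$2, M$5$3, M$5$4, M$5$5]])"
    by (simp add: block_mat_def vec5_eq_iff)
qed

lemma block_mat_add: "block_mat a b c D + block_mat a' b' c' D' = block_mat (a + a') (b + b') (c +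
  c') (D + D')"
  by (simp add: block_mat_def vec5_eq_iff)

lemma block_mat_diff: "block_mat a b c D - block_mat a' b' c' D' = block_mat (a - a') (b - b') (c
  - c') (D - D')"
  by (simp add: block_mat_def vec5_eq_iff)

lemma scaleR_block_mat: "r *\<^sub>R block_mat a b c D = block_mat (r * a) (r *\<^sub>R b) (r *\<^sub>R c) (r *\<^sub>R D)"
  by (simp add: block_mat_def vec5_eq_iff)

lemma block_mat_0: "block_mat 0 0 0 0 = 0"
  by (simp add: block_mat_def vec5_eq_iff)

lemma block_mat_1: "block_mat 1 0 0 (mat 1) = mat 1"
  by (simp add: block_mat_def vec5_eq_iff mat_def)

section \<open>The identity component of the group preserving the form\<close>

abbreviation preserves_form :: "mat5 \<Rightarrow> bool" where
  "preserves_form g \<equiv> transpose g ** lorentz_form ** g = lorentz_form"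

lemma matrix_add_rdistrib: "((A::real^'n^'m) + B) ** C = A ** C + B ** C"
  by (simp add: matrix_matrix_mult_def vec_eq_iff sum.distrib algebra_simps)

lemma transpose_add: "transpose (A + B) = transpose A + transpose (B::real^'n^'m)"
  by (simp add: transpose_def vec_eq_iff)

text \<open>The linearized form of \<^const>\<open>preserves_form\<close>, which conjugation and the exponential respect
  without any computation in coordinates.\<close>

lemma so14_iff: "Y \<in> so14 \<longleftrightarrow> transpose Y ** lorentz_form + lorentz_form ** Y = 0"
proof -
  obtain a b c D where Y: "Y = block_mat a b c D" by (rule block_mat_cases)
  have "transpose Y ** lorentz_form + lorentz_form ** Y
        = block_mat (2 * a) (b - c) (b - c) (- (transpose D + D))"
    by (simp add: Y lorentz_form_def block_mat_def vec5_eq_iff matrix_matrix_mult_def 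
       sum_5 transpose_def mat_def)
  then have "transpose Y ** lorentz_form + lorentz_form ** Y = 0
     \<longleftrightarrow> a = 0 \<and> b = c \<and> - (transpose D + D) = 0"
    by (simp flip: block_mat_0)
  moreover have "- (transpose D + D) = 0 \<longleftrightarrow> transpose D = - D"
    by (simp only: neg_equal_0_iff_equal eq_neg_iff_add_eq_0)
  moreover have "Y \<in> so14 \<longleftrightarrow> a = 0 \<and> b = c \<and> transpose D = - D"
    by (auto simp: Y so14_def)
  ultimately show ?thesis by simp
qed

lemma lorentz_form_sq: "lorentz_form ** lorentz_form = mat 1"
  by (simp add: lorentz_form_def block_mat_mult block_mat_1[symmetric])
   (simp add: vec_eq_iff outer_def matrix_matrix_mult_def mat_def sum_4 forall_4)

lemma det_preserves_form: "preserves_form g \<Longrightarrow> det g = 1 \<or> det g = -1"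
proof -
  assume "preserves_form g"
  then have "det (transpose g ** lorentz_form ** g) = det lorentz_form" by simp
  then have "det lorentz_form * (det g * det g) = det lorentz_form"
    by (simp add: det_mul det_transpose algebra_simps)
  moreover have "det lorentz_form * det lorentz_form = 1"
    by (metis lorentz_form_sq det_mul det_I)
  ultimately have "det g * det g = 1" by (metis mult_cancel_left2 mult_zero_left zero_neq_one)
  then show ?thesis by (metis square_eq_1_iff)
qed

lemma continuous_on_det:
  fixes f :: "'a::topological_space \<Rightarrow> real^'n^'n"
  shows "continuous_on S f \<Longrightarrow> continuous_on S (\<lambda>x. det (f x))"
  unfolding det_def by (intro continuous_intros)

text \<open>A continuous function with values in \<open>{1, -1}\<close> is constant on a connected set.  The
  determinants of the group elements and of left multiplications by unit quaternions are found in
  this way.\<close>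

lemma connected_det_eq_1:
  fixes S :: "(real^'n^'n) set"
  assumes "connected S" "mat 1 \<in> S" "\<And>g. g \<in> S \<Longrightarrow> det g = 1 \<or> det g = -1" "h \<in> S"
  shows "det h = 1"
proof (rule ccontr)
  assume "det h \<noteq> 1"
  then have "det h = -1" using assms by blast
  have "connected (det ` S)"
    by (intro connected_continuous_image continuous_on_det continuous_on_id assms)
  moreover have "1 \<in> det ` S" using assms(2) det_I by (metis imageI)
  moreover have "-1 \<in> det ` S" using assms(4) \<open>det h = -1\<close> by (metis imageI)
  ultimately have "0 \<in> det ` S" using connectedD_interval[of "det ` S" "-1" 1 0] by simp
  then show False using assms(3) by force
qed

text \<open>The criterion for membership used throughout: it suffices to join a matrix to the identity by
  matrices that preserve the form, since the determinant then stays 1 by continuity.\<close>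

lemma connected_imp_in_G14:
  assumes "connected S" "mat 1 \<in> S" "\<And>g. g \<in> S \<Longrightarrow> preserves_form g" "h \<in> S"
  shows "h \<in> G14"
proof -
  have "det g = 1" if "g \<in> S" for g
    by (rule connected_det_eq_1[of S]) (use assms that det_preserves_form in auto)
  then have "S \<subseteq> G14"
    unfolding G14_def using assms by (intro connected_component_maximal) auto
  then show ?thesis using assms by blast
qed

lemma G14_obtain_connected:
  assumes "g \<in> G14"
  obtains S where "connected S" "mat 1 \<in> S" "g \<in> S" "\<And>g. g \<in> S \<Longrightarrow> preserves_form g"
  using assms unfolding G14_def connected_component_def by (auto simp: subset_iff)

lemma G14_form: "g \<in> G14 \<Longrightarrow> preserves_form g"
  by (meson G14_obtain_connected)

lemma form_matrix_inv:
  assumes "preserves_form g"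
  shows "invertible g" "matrix_inv g ** g = mat 1" "g ** matrix_inv g = mat 1"
proof -
  show inv: "invertible g" using det_preserves_form[OF assms] by (auto simp: invertible_det_nz)
  show 1: "matrix_inv g ** g = mat 1" and 2: "g ** matrix_inv g = mat 1"
    using inv unfolding invertible_def matrix_inv_def by (metis (mono_tags, lifting) someI_ex)+
qed

lemma preserves_form_mult:
  assumes "preserves_form g" "preserves_form h" shows "preserves_form (g ** h)"
proof -
  have "transpose (g ** h) ** lorentz_form ** (g ** h)
      = transpose h ** (transpose g ** lorentz_form ** g) ** h"
    by (simp only: matrix_mul_assoc matrix_transpose_mul)
  then show ?thesis using assms by simp
qed

lemma preserves_form_inv:
  assumes "preserves_form g" shows "preserves_form (matrix_inv g)"
proof -
  let ?h = "matrix_inv g"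
  have "transpose ?h ** lorentz_form ** ?h = transpose ?h ** (transpose g ** lorentz_form ** g) ** ?h"
    using assms by simp
  also have "\<dots> = transpose (g ** ?h) ** lorentz_form ** (g ** ?h)"
    by (simp only: matrix_mul_assoc matrix_transpose_mul)
  also have "\<dots> = lorentz_form" by (simp add: form_matrix_inv(3)[OF assms])
  finally show ?thesis .
qed

lemma continuous_on_matrix_mult [continuous_intros]:
  fixes f :: "'a::topological_space \<Rightarrow> real^'n^'m" and g :: "'a \<Rightarrow> real^'p^'n"
  assumes "continuous_on S f" "continuous_on S g"
  shows "continuous_on S (\<lambda>x. f x ** g x)"
  unfolding matrix_matrix_mult_def using assms by (intro continuous_intros)


lemma G14_mult:
  assumes "g \<in> G14" "h \<in> G14" shows "g ** h \<in> G14"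
proof -
  obtain S where S: "connected S" "mat 1 \<in> S" "g \<in> S" "\<And>g. g \<in> S \<Longrightarrow> preserves_form g"
    using G14_obtain_connected[OF assms(1)] by metis
  obtain T where T: "connected T" "mat 1 \<in> T" "h \<in> T" "\<And>g. g \<in> T \<Longrightarrow> preserves_form g"
    using G14_obtain_connected[OF assms(2)] by metis
  show ?thesis
  proof (rule connected_imp_in_G14)
    show "connected ((\<lambda>(x, y). x ** y) ` (S \<times> T))"
      unfolding split_def
      by (intro connected_continuous_image continuous_intros connected_Times S T)
    show "mat 1 \<in> (\<lambda>(x, y). x ** y) ` (S \<times> T)" using S T by force
    show "g ** h \<in> (\<lambda>(x, y). x ** y) ` (S \<times> T)" using S T by force
  qed (use S T preserves_form_mult in force)
qed

lemma G14_inv: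
  assumes "g \<in> G14" shows "matrix_inv g \<in> G14"
proof -
  obtain S where S: "connected S" "mat 1 \<in> S" "g \<in> S" "\<And>g. g \<in> S \<Longrightarrow> preserves_form g"
    using G14_obtain_connected[OF assms(1)] by metis
  show ?thesis
  proof (rule connected_imp_in_G14)
    show "connected ((\<lambda>x. matrix_inv g ** x) ` S)"
      by (intro connected_continuous_image continuous_intros S)
    show "mat 1 \<in> (\<lambda>x. matrix_inv g ** x) ` S"
      using S form_matrix_inv by (metis imageI)
    show "matrix_inv g \<in> (\<lambda>x. matrix_inv g ** x) ` S"
      using S by (metis imageI matrix_mul_rid)
  qed (use S preserves_form_mult preserves_form_inv in force)
qed

lemma mat1_in_G14: "mat 1 \<in> G14"
  by (rule connected_imp_in_G14[of "{mat 1}"]) (auto simp: transpose_mat)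

section \<open>The adjoint action\<close>

lemma matrix_inv_eqI: 
  fixes A B :: "real^'n^'n"
  assumes "A ** B = mat 1" shows "matrix_inv A = B"
proof -
  have "B ** A = mat 1" using assms matrix_left_right_inverse by blast
  then have inv: "A ** matrix_inv A = mat 1 \<and> matrix_inv A ** A = mat 1"
    unfolding matrix_inv_def using assms by (metis (mono_tags, lifting) someI_ex)
  have "matrix_inv A = (B ** A) ** matrix_inv A" by (simp add: \<open>B ** A = mat 1\<close>)
  also have "\<dots> = B ** (A ** matrix_inv A)" by (simp only: matrix_mul_assoc)
  also have "\<dots> = B" using inv by simp
  finally show ?thesis .
qed

lemma Ad_intertwine:
  assumes "preserves_form g" shows "Ad g Y ** g = g ** Y"
  by (simp add: Ad_def form_matrix_inv[OF assms] flip: matrix_mul_assoc)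

lemma Ad_vec:
  assumes "preserves_form g" shows "Ad g Y *v (g *v u) = g *v (Y *v u)"
  using Ad_intertwine[OF assms] by (simp add: matrix_vector_mul_assoc)

lemma Ad_inv:
  assumes "preserves_form g" shows "Ad g (Ad (matrix_inv g) Y) = Y"
proof -
  have "matrix_inv (matrix_inv g) = g"
    by (intro matrix_inv_eqI form_matrix_inv assms)
  then have "Ad g (Ad (matrix_inv g) Y) = (g ** matrix_inv g) ** Y ** (g ** matrix_inv g)"
    by (simp add: Ad_def matrix_mul_assoc)
  then show ?thesis by (simp add: form_matrix_inv[OF assms])
qed

text \<open>With \<open>Z = Ad g Y\<close>, the defect \<open>A\<close> of \<open>Z\<close> in \<open>so14_iff\<close> pulls back along \<open>g\<close> to the defect
  of \<open>Y\<close>, because \<open>Z g = g Y\<close>; and pulling back along an invertible matrix loses nothing.\<close>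

lemma Ad_so14:
  assumes g: "preserves_form g" and Y: "Y \<in> so14" shows "Ad g Y \<in> so14"
proof -
  let ?Z = "Ad g Y" and ?h = "matrix_inv g"
  define A where "A = transpose ?Z ** lorentz_form + lorentz_form ** ?Z"
  have "transpose g ** A ** g = transpose (?Z ** g) ** lorentz_form ** g + transpose g **
    lorentz_form ** (?Z ** g)"
    by (simp add: A_def matrix_add_ldistrib matrix_add_rdistrib matrix_transpose_mul matrix_mul_assoc)
  also have "\<dots> = transpose Y ** (transpose g ** lorentz_form ** g) + (transpose g ** lorentz_form
    ** g) ** Y"
    by (simp add: Ad_intertwine[OF g] matrix_transpose_mul matrix_mul_assoc)
  also have "\<dots> = 0" using Y by (simp add: g so14_iff)
  finally have 0: "transpose g ** A ** g = 0" .
  have "A = transpose (g ** ?h) ** A ** (g ** ?h)"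
    by (simp add: form_matrix_inv[OF g] transpose_mat)
  also have "\<dots> = transpose ?h ** (transpose g ** A ** g) ** ?h"
    by (simp only: matrix_transpose_mul matrix_mul_assoc)
  also have "\<dots> = 0" by (simp add: 0)
  finally show ?thesis by (simp add: so14_iff A_def)
qed

section \<open>The parabolic algebra and its normalizer\<close>

abbreviation qone :: quat where "qone \<equiv> vector [1, 0, 0, 0]"

definition base_null :: "real^5" where "base_null = event 1 qone"

lemma Hel_event: "Hel *v event s x = event (x$1) (s *\<^sub>R qone)"
  by (simp add: Hel_def block_mat_event inner_4)

text \<open>The eigenvalues of \<^const>\<open>Hel\<close> on \<^typ>\<open>real^5\<close> are 1, 0 and -1, and 1 is simple with
  eigenvector \<^const>\<open>base_null\<close>.\<close>

lemma Hel_eigenvector: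
  assumes "Hel *v u = m *\<^sub>R u" "m \<ge> 1"
  shows "u = u$1 *\<^sub>R base_null"
proof -
  obtain s x where u: "u = event s x" by (metis event_space_part)
  have *: "x$1 = m * s \<and> s *\<^sub>R qone = m *\<^sub>R x"
    using assms(1) unfolding u Hel_event scaleR_event event_eq_iff .
  then have "s *\<^sub>R qone $ i = m *\<^sub>R x $ i" for i by (metis vector_scaleR_component)
  from this[of 1] this[of 2] this[of 3] this[of 4]
  have e: "s = m * x$1" "x$2 = 0" "x$3 = 0" "x$4 = 0" using assms(2) by simp_all
  have "(m + 1) * (x$1 - s) = (x$1 - m * s) + (m * x$1 - s)" by (simp add: algebra_simps)
  also have "\<dots> = 0" using * e(1) by linarith
  finally have "x$1 = s" using assms(2) by simp
  with e(2-) show ?thesis by (simp add: u base_null_def scaleR_event vec4_eq_iff)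
qed

lemma subspace_so14: "subspace so14"
  unfolding subspace_def
proof (intro conjI ballI allI)
  show "0 \<in> so14" by (simp add: so14_iff matrix_matrix_mult_def transpose_def vec_eq_iff)
  fix x y :: mat5 and c :: real assume "x \<in> so14" "y \<in> so14"
  then show "x + y \<in> so14" "c *\<^sub>R x \<in> so14"
    by (auto simp: so14_def block_mat_add scaleR_block_mat transpose_add transpose_scalar)
qed

lemma par_algI:
  "Y \<in> so14 \<Longrightarrow> mat_bracket Hel Y = l *\<^sub>R Y \<Longrightarrow> l \<ge> 0 \<Longrightarrow> Y \<in> par_alg"
  unfolding par_alg_def by (intro span_base UN_I[of l]) auto

text \<open>An eigenvector of \<open>ad Hel\<close> with eigenvalue \<open>l\<close> raises eigenvalues of \<^const>\<open>Hel\<close> by \<open>l\<close>; for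
  \<open>l \<ge> 0\<close> it sends \<^const>\<open>base_null\<close>, which has the largest eigenvalue, to a multiple of itself.
  Conversely, an element with eigenvector \<^const>\<open>base_null\<close> is the sum of a part that commutes with
  \<^const>\<open>Hel\<close> and a part in the eigenspace for 1.\<close>

lemma par_alg_eq_eigenvector: "par_alg = {Y \<in> so14. \<exists>c. Y *v base_null = c *\<^sub>R base_null}" (is "_ = ?R")
proof
  have sub: "subspace ?R"
    unfolding subspace_def
  proof (intro conjI ballI allI)
    show "0 \<in> ?R" using subspace_so14 by (auto simp: subspace_0 intro: exI[of _ 0])
    fix x y and r :: real assume "x \<in> ?R" "y \<in> ?R"
    then obtain c d where xy: "x \<in> so14" "y \<in> so14" "x *v base_null = c *\<^sub>R base_null" "y *v
      base_null = d *\<^sub>R base_null"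
      by blast
    then have "(x + y) *v base_null = (c + d) *\<^sub>R base_null"
      by (simp add: matrix_vector_mult_add_rdistrib scaleR_add_left)
    then show "x + y \<in> ?R" using subspace_add[OF subspace_so14 xy(1,2)] by blast
    have "(r *\<^sub>R x) *v base_null = (r * c) *\<^sub>R base_null"
      by (simp add: xy flip: scaleR_matrix_vector_assoc)
    then show "r *\<^sub>R x \<in> ?R" using subspace_scale[OF subspace_so14 xy(1)] by blast
  qed
  have "Y \<in> ?R" if Y: "Y \<in> so14" "mat_bracket Hel Y = l *\<^sub>R Y" "l \<ge> 0" for Y l
  proof -
    have "Hel *v (Y *v base_null) - Y *v (Hel *v base_null) = l *\<^sub>R (Y *v base_null)"
      using Y(2) unfolding mat_bracket_def
      by (metis matrix_vector_mul_assoc matrix_vector_mult_diff_rdistrib scaleR_matrix_vector_assoc)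
    moreover have "Hel *v base_null = base_null" by (simp add: base_null_def Hel_event)
    ultimately have "Hel *v (Y *v base_null) = (l + 1) *\<^sub>R (Y *v base_null)"
      by (simp add: algebra_simps)
    then have "Y *v base_null = ((Y *v base_null)$1) *\<^sub>R base_null"
      by (rule Hel_eigenvector) (use Y(3) in simp)
    then show ?thesis using Y by blast
  qed
  then show "par_alg \<subseteq> ?R"
    unfolding par_alg_def by (intro span_minimal sub) auto
  show "?R \<subseteq> par_alg"
  proof
    fix Y assume "Y \<in> ?R"
    then obtain c b D where Y: "Y = block_mat 0 b b D" "transpose D = - D" "Y *v base_null = c *\<^sub>R
      base_null"
      by (auto simp: so14_def)
    have skew: "D$j$i = - (D$i$j)" for i j
      using arg_cong[OF Y(2), of "\<lambda>A. A$i$j"] by (simp add: transpose_def)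
    have d0: "D$1$1 = 0" "D$2$2 = 0" "D$3$3 = 0" "D$4$4 = 0" 
      using skew[of 1 1] skew[of 2 2] skew[of 3 3] skew[of 4 4] by linarith+
    have d: "D$2$1 = - (b$2)" "D$3$1 = - (b$3)" "D$4$1 = - (b$4)"
    proof -
      have "b + D *v qone = c *\<^sub>R qone"
        using Y(3) unfolding Y(1) base_null_def block_mat_event scaleR_event event_eq_iff by simp
      then have "b$i + D$i$1 = c * qone$i" for i
        by (simp add: vec_eq_iff matrix_vector_mult_def sum_4)
      from this[of 2] this[of 3] this[of 4]
      show "D$2$1 = - (b$2)" "D$3$1 = - (b$3)" "D$4$1 = - (b$4)" by simp_all
    qed
    note d = d skew[of 2 1] skew[of 3 1] skew[of 4 1]
    \<comment> \<open>\<open>Y0\<close> commutes with \<^const>\<open>Hel\<close>: it keeps the first boost parameter and the rotations that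
      fix \<^term>\<open>qone\<close>.  The rest of \<open>Y\<close> has eigenvalue 1.\<close>
    let ?b0 = "vector [b$1, 0, 0, 0] :: quat"
    let ?D0 = "vector [0, vector [0, D$2$2, D$2$3, D$2$4], vector [0, D$3$2, D$3$3, D$3$4],
       vector [0, D$4$2, D$4$3, D$4$4]] :: real^4^4"
    let ?Y0 = "block_mat 0 ?b0 ?b0 ?D0"
    have "transpose ?D0 = - ?D0"
      using skew[of 2 3] skew[of 2 4] skew[of 3 4] by (simp add: vec4_eq_iff transpose_def d0)
    then have s0: "?Y0 \<in> so14" unfolding so14_def by blast
    moreover have "mat_bracket Hel ?Y0 = 0 *\<^sub>R ?Y0"
      unfolding mat_bracket_def Hel_def block_mat_mult block_mat_diff scaleR_block_mat
      by (simp add: vec4_eq_iff inner_4 matrix_vector_mult_def vector_matrix_mult_def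
        matrix_matrix_mult_def outer_def sum_4)
    ultimately have 0: "?Y0 \<in> par_alg" by (rule par_algI) simp
    have "Y - ?Y0 \<in> so14" using \<open>Y \<in> ?R\<close> s0 subspace_so14 by (simp add: subspace_diff)
    moreover have "mat_bracket Hel (Y - ?Y0) = 1 *\<^sub>R (Y - ?Y0)"
      unfolding mat_bracket_def Hel_def block_mat_mult block_mat_diff scaleR_block_mat Y(1)
      using d0 d
      by (simp add: vec4_eq_iff inner_4 matrix_vector_mult_def vector_matrix_mult_def
        matrix_matrix_mult_def outer_def sum_4)
    ultimately have 1: "Y - ?Y0 \<in> par_alg" by (rule par_algI) simp
    have "?Y0 + (Y - ?Y0) \<in> par_alg"
      using 0 1 unfolding par_alg_def by (rule span_add)
    then show "Y \<in> par_alg" by simp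
  qed
qed

lemma lorentz_form_event: "lorentz_form *v event s x = event s (- x)"
  unfolding lorentz_form_def block_mat_event
  by (simp add: vec4_eq_iff matrix_vector_mult_def mat_def sum_4)

lemma inner_event: "event s x \<bullet> event t y = s * t + x \<bullet> y"
  by (simp add: event_def inner_4 inner_vec_def sum_5)

lemma form_preserved:
  assumes "preserves_form g" shows "(g *v u) \<bullet> (lorentz_form *v (g *v u)) = u \<bullet> (lorentz_form *v u)"
proof -
  have "(g *v u) \<bullet> (lorentz_form *v (g *v u)) = u \<bullet> ((transpose g ** lorentz_form ** g) *v u)"
    by (simp only: matrix_vector_mul_assoc[symmetric] dot_lmul_matrix[symmetric] vector_transpose_matrix)
  then show ?thesis using assms by simp
qed

lemma base_null_nonzero: "base_null \<noteq> 0"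
  by (simp add: base_null_def event_def vec5_eq_iff)

lemma preserves_form_kernel: "preserves_form g \<Longrightarrow> g *v u = 0 \<longleftrightarrow> u = 0"
  by (metis form_matrix_inv(2) matrix_vector_mul_assoc matrix_vector_mul_lid matrix_vector_mult_0_right)

text \<open>An eigenvector \<open>v\<close> of \<open>Y\<close> becomes the eigenvector \<open>g v\<close> of \<open>Ad g Y\<close>, and here \<open>g v\<close> is a
  multiple of \<open>v\<close>.\<close>

lemma Ad_par_alg_subset:
  assumes g: "preserves_form g" and c: "g *v base_null = c *\<^sub>R base_null"
  shows "Ad g ` par_alg \<subseteq> par_alg"
proof
  fix Z assume "Z \<in> Ad g ` par_alg"
  then obtain Y d where Y: "Z = Ad g Y" "Y \<in> so14" "Y *v base_null = d *\<^sub>R base_null"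
    by (auto simp: par_alg_eq_eigenvector)
  have "c \<noteq> 0" using c preserves_form_kernel[OF g] base_null_nonzero by force
  have "c *\<^sub>R (Z *v base_null) = Z *v (g *v base_null)" by (simp add: c matrix_vector_mult_scaleR)
  also have "\<dots> = g *v (Y *v base_null)" unfolding Y(1) by (rule Ad_vec[OF g])
  also have "\<dots> = c *\<^sub>R (d *\<^sub>R base_null)" by (simp add: Y(3) c matrix_vector_mult_scaleR mult.commute)
  finally have "Z *v base_null = d *\<^sub>R base_null" using \<open>c \<noteq> 0\<close> by (simp only: scaleR_cancel_left) simp
  then show "Z \<in> par_alg" using Y Ad_so14[OF g] by (auto simp: par_alg_eq_eigenvector)
qed

lemma fixed_line_inv:
  assumes g: "preserves_form g" and c: "g *v base_null = c *\<^sub>R base_null"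
  shows "c \<noteq> 0" "matrix_inv g *v base_null = (1 / c) *\<^sub>R base_null"
proof -
  show "c \<noteq> 0" using c preserves_form_kernel[OF g] base_null_nonzero by force
  have "base_null = matrix_inv g *v (g *v base_null)"
    by (simp add: matrix_vector_mul_assoc form_matrix_inv[OF g])
  then have "base_null = c *\<^sub>R (matrix_inv g *v base_null)" by (simp add: c matrix_vector_mult_scaleR)
  then show "matrix_inv g *v base_null = (1 / c) *\<^sub>R base_null"
    using \<open>c \<noteq> 0\<close> by (metis divide_inverse_commute divide_self_if scaleR_one scaleR_scaleR
      mult.right_neutral)
qed

text \<open>Two elements of the algebra suffice to single out the null line.  A null eigenvector of
  \<^const>\<open>Hel\<close> is a multiple of \<^term>\<open>event 1 qone\<close> or of \<^term>\<open>event 1 (- qone)\<close>, and the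
  nilpotent matrix \<open>N\<close> moves the second one off its line.\<close>

lemma par_alg_common_eigenvector:
  assumes null: "u \<bullet> (lorentz_form *v u) = 0" and eig: "\<And>Y. Y \<in> par_alg \<Longrightarrow> \<exists>c. Y *v u = c *\<^sub>R u"
  shows "\<exists>s. u = s *\<^sub>R base_null"
proof -
  obtain s x where u: "u = event s x" by (metis event_space_part)
  \<comment> \<open>\<open>N\<close> has eigenvalue 1 under \<open>ad Hel\<close> and annihilates \<^const>\<open>base_null\<close>.\<close>
  let ?b = "vector [0, 1, 0, 0] :: quat"
  let ?D = "vector [vector [0, 1, 0, 0], vector [-1, 0, 0, 0], 0, 0] :: real^4^4"
  let ?N = "block_mat 0 ?b ?b ?D"
  have N: "?N *v event t y = event (y$2) (vector [y$2, t - y$1, 0, 0])" for t y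
    unfolding block_mat_event by (simp add: inner_4 vec4_eq_iff matrix_vector_mult_def sum_4)
  have "transpose ?D = - ?D" by (simp add: transpose_def vec4_eq_iff)
  then have "?N \<in> so14" by (auto simp: so14_def)
  moreover have "?N *v base_null = 0 *\<^sub>R base_null"
    by (simp add: base_null_def N) (simp add: event_def vec5_eq_iff)
  ultimately have "?N \<in> par_alg" unfolding par_alg_eq_eigenvector by blast
  then obtain c' where N': "x$2 = c' * s" "vector [x$2, s - x$1, 0, 0] = c' *\<^sub>R x"
    using eig[of ?N] unfolding u N scaleR_event event_eq_iff by blast
  have c': "s - x$1 = c' * x$2" using arg_cong[OF N'(2), of "\<lambda>y. y$2"] by simp
  have "transpose (0 :: real^4^4) = - 0" by (simp add: transpose_def vec_eq_iff)
  then have "Hel \<in> so14" unfolding so14_def Hel_def by blast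
  moreover have "Hel *v base_null = 1 *\<^sub>R base_null" by (simp add: base_null_def Hel_event)
  ultimately have "Hel \<in> par_alg" unfolding par_alg_eq_eigenvector by blast
  then obtain c where H: "x$1 = c * s" "s *\<^sub>R qone = c *\<^sub>R x"
    using eig[of Hel] unfolding u Hel_event scaleR_event event_eq_iff by blast
  have c: "s = c * x$1" "c * x$2 = 0" "c * x$3 = 0" "c * x$4 = 0"
    using arg_cong[OF H(2), of "\<lambda>y. y$1"] arg_cong[OF H(2), of "\<lambda>y. y$2"]
      arg_cong[OF H(2), of "\<lambda>y. y$3"] arg_cong[OF H(2), of "\<lambda>y. y$4"] by simp_all
  have "s * s = x \<bullet> x" using null by (simp add: u lorentz_form_event inner_event)
  have "x$1 = s \<and> x$2 = 0 \<and> x$3 = 0 \<and> x$4 = 0"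
  proof (cases "c = 0")
    case True
    then have "x$1 = 0" "s = 0" using H(1) c(1) by simp_all
    then have "x = 0" using \<open>s * s = x \<bullet> x\<close> by simp
    then show ?thesis using \<open>s = 0\<close> by simp
  next
    case False
    then have x: "x$2 = 0" "x$3 = 0" "x$4 = 0" using c by simp_all
    then show ?thesis using c' by simp
  qed
  then have "u = s *\<^sub>R base_null" by (simp add: u base_null_def scaleR_event vec4_eq_iff)
  then show ?thesis ..
qed

lemma base_null_null: "base_null \<bullet> (lorentz_form *v base_null) = 0"
  by (simp add: base_null_def lorentz_form_event inner_event inner_4)

text \<open>If \<open>g\<close> normalizes the algebra, then every element of the algebra has the null vector
  \<open>g\<^sup>-\<^sup>1 base_null\<close> as an eigenvector, so this vector lies on the line of \<^const>\<open>base_null\<close>.\<close>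

lemma P_min_eq_line_stabilizer: "P_min = {g \<in> G14. \<exists>c. g *v base_null = c *\<^sub>R base_null}" (is "_ = ?R")
proof
  show "P_min \<subseteq> ?R"
  proof
    fix g assume "g \<in> P_min"
    then have g: "g \<in> G14" "Ad g ` par_alg = par_alg" by (auto simp: P_min_def)
    note f = G14_form[OF g(1)]
    define u where "u = matrix_inv g *v base_null"
    have gu: "g *v u = base_null" by (simp add: u_def matrix_vector_mul_assoc form_matrix_inv[OF f])
    have "\<exists>c. Y *v u = c *\<^sub>R u" if "Y \<in> par_alg" for Y
    proof -
      have "Ad g Y \<in> par_alg" using g that by blast
      then obtain c where "Ad g Y *v base_null = c *\<^sub>R base_null" by (auto simp: par_alg_eq_eigenvector)
      then have "g *v (Y *v u) = g *v (c *\<^sub>R u)"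
        by (simp add: Ad_vec[OF f] matrix_vector_mult_scaleR gu flip: gu)
      then have "g *v (Y *v u - c *\<^sub>R u) = 0" by (simp add: matrix_vector_mult_diff_distrib)
      then have "Y *v u = c *\<^sub>R u" by (simp add: preserves_form_kernel[OF f])
      then show ?thesis ..
    qed
    moreover have "u \<bullet> (lorentz_form *v u) = 0"
      using form_preserved[OF f, of u] base_null_null by (simp add: gu)
    ultimately obtain s where s: "u = s *\<^sub>R base_null" using par_alg_common_eigenvector by blast
    then have "base_null = s *\<^sub>R (g *v base_null)" using gu by (simp add: matrix_vector_mult_scaleR)
    moreover from this have "s \<noteq> 0" using base_null_nonzero by auto
    ultimately have "g *v base_null = (1 / s) *\<^sub>R base_null"
      by (metis divide_self_if scaleR_one scaleR_scaleR times_divide_eq_left mult_1)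
    then show "g \<in> ?R" using g by blast
  qed
  show "?R \<subseteq> P_min"
  proof
    fix g assume "g \<in> ?R"
    then obtain c where g: "g \<in> G14" and c: "g *v base_null = c *\<^sub>R base_null" by blast
    note f = G14_form[OF g]
    have sub: "Ad g ` par_alg \<subseteq> par_alg" by (rule Ad_par_alg_subset[OF f c])
    have "Ad (matrix_inv g) ` par_alg \<subseteq> par_alg"
      by (rule Ad_par_alg_subset[OF preserves_form_inv[OF f] fixed_line_inv(2)[OF f c]])
    then have "par_alg \<subseteq> Ad g ` par_alg"
      using Ad_inv[OF f] by (metis image_subset_iff subsetI imageI)
    then show "g \<in> P_min" using sub g by (auto simp: P_min_def)
  qed
qed

section \<open>The flag manifold as the sphere of null lines\<close>

lemma mat1_in_P_min: "mat 1 \<in> P_min"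
  using mat1_in_G14 by (auto simp: P_min_eq_line_stabilizer intro: exI[of _ 1])

lemma coset_P_subset:
  assumes g: "g \<in> G14" and h: "h \<in> G14" and c: "h *v base_null = c *\<^sub>R (g *v base_null)"
  shows "coset_P h \<subseteq> coset_P g"
proof
  fix k assume "k \<in> coset_P h"
  then obtain p d where p: "k = h ** p" "p \<in> G14" "p *v base_null = d *\<^sub>R base_null"
    by (auto simp: coset_P_def P_min_eq_line_stabilizer)
  note f = G14_form[OF g]
  let ?q = "matrix_inv g ** (h ** p)"
  have "?q *v base_null = matrix_inv g *v (h *v (p *v base_null))" by (simp add: matrix_vector_mul_assoc)
  also have "\<dots> = (c * d) *\<^sub>R (matrix_inv g *v (g *v base_null))"
    by (simp add: p c matrix_vector_mult_scaleR mult.commute)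
  also have "\<dots> = (c * d) *\<^sub>R base_null" by (simp add: matrix_vector_mul_assoc form_matrix_inv[OF f])
  finally have "?q \<in> P_min" using g h p by (auto simp: P_min_eq_line_stabilizer intro: G14_mult G14_inv)
  moreover have "k = g ** ?q" by (simp add: p(1) matrix_mul_assoc form_matrix_inv[OF f])
  ultimately show "k \<in> coset_P g" unfolding coset_P_def by blast
qed

lemma coset_P_eqI:
  assumes g: "g \<in> G14" and h: "h \<in> G14" and c: "h *v base_null = c *\<^sub>R (g *v base_null)"
  shows "coset_P h = coset_P g"
proof
  have "c \<noteq> 0" using c preserves_form_kernel[OF G14_form[OF h]] base_null_nonzero by force
  then have "g *v base_null = (1 / c) *\<^sub>R (h *v base_null)" by (simp add: c)
  then show "coset_P g \<subseteq> coset_P h" by (rule coset_P_subset[OF h g])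
qed (rule coset_P_subset[OF g h c])

text \<open>The point of the sphere that represents the line through a null vector.  The quotient does not
  depend on the scaling of the vector, and not on its time orientation either.\<close>

definition sphere_point :: "real^5 \<Rightarrow> quat" where
  "sphere_point u = space_part u /\<^sub>R u$1"

lemma sphere_point_scaleR: "c \<noteq> 0 \<Longrightarrow> sphere_point (c *\<^sub>R u) = sphere_point u"
  by (simp add: sphere_point_def linear_cmul[OF linear_space_part])

lemma sphere_point_event [simp]: "sphere_point (event 1 x) = x"
  by (simp add: sphere_point_def)

lemma sphere_point_of_null:
  assumes g: "preserves_form g" and x: "x \<in> S3"
  defines "u \<equiv> g *v event 1 x"
  shows "u$1 \<noteq> 0" "sphere_point u \<in> S3" "u = u$1 *\<^sub>R event 1 (sphere_point u)"
proof -
  obtain s y where u: "u = event s y" by (metis event_space_part)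
  have "x \<bullet> x = 1" using x by (simp add: norm_eq_1)
  then have "u \<bullet> (lorentz_form *v u) = 0"
    unfolding u_def form_preserved[OF g] by (simp add: lorentz_form_event inner_event)
  then have s: "s * s = y \<bullet> y" by (simp add: u lorentz_form_event inner_event)
  have "event 1 x \<noteq> 0" by (simp add: event_def vec5_eq_iff)
  then have "u \<noteq> 0" unfolding u_def by (simp add: preserves_form_kernel[OF g])
  have "s \<noteq> 0"
  proof
    assume "s = 0"
    then have "y = 0" using s by simp
    with \<open>s = 0\<close> \<open>u \<noteq> 0\<close> show False by (simp add: u event_def vec5_eq_iff)
  qed
  then show "u$1 \<noteq> 0" by (simp add: u)
  have "sphere_point u \<bullet> sphere_point u = (inverse s * s) * (inverse s * s)"
    by (simp add: sphere_point_def u s[symmetric])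
  then have "sphere_point u \<bullet> sphere_point u = 1" using \<open>s \<noteq> 0\<close> by simp
  then show "sphere_point u \<in> S3" by (simp add: norm_eq_1)
  show "u = u$1 *\<^sub>R event 1 (sphere_point u)" using \<open>s \<noteq> 0\<close> by (simp add: u sphere_point_def scaleR_event)
qed

definition lmul :: "quat \<Rightarrow> real^4^4" where
  "lmul x = (\<chi> i j. (x \<odot> axis j 1)$i)"

definition rmul :: "quat \<Rightarrow> real^4^4" where
  "rmul x = (\<chi> i j. (axis j 1 \<odot> x)$i)"

lemma lmul_vec: "lmul x *v y = x \<odot> y"
  by (simp add: lmul_def qmul_def vec4_eq_iff matrix_vector_mult_def sum_4 axis_def)

lemma rmul_vec: "rmul x *v y = y \<odot> x"
  by (simp add: rmul_def qmul_def vec4_eq_iff matrix_vector_mult_def sum_4 axis_def)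

lemma linear_lmul: "linear lmul"
  by (intro linearI) (simp_all add: lmul_def qmul_def vec4_eq_iff algebra_simps)

lemma linear_rmul: "linear rmul"
  by (intro linearI) (simp_all add: rmul_def qmul_def vec4_eq_iff algebra_simps)

lemma lmul_orthogonal:
  assumes "x \<in> S3" shows "orthogonal_matrix (lmul x)"
proof -
  have "x$1 * x$1 + x$2 * x$2 + x$3 * x$3 + x$4 * x$4 = 1"
    using assms by (simp add: norm_eq_1 inner_4)
  then show ?thesis unfolding orthogonal_matrix
    by (simp add: lmul_def qmul_def axis_def vec4_eq_iff transpose_def matrix_matrix_mult_def
      sum_4 mat_def algebra_simps)
qed

lemma lmul_one: "lmul qone = mat 1"
  by (simp add: lmul_def qmul_def axis_def vec4_eq_iff mat_def)

lemma qone_S3: "qone \<in> S3"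
  by (simp add: norm_eq_1 inner_4)

text \<open>The determinant is 1 because the sphere of unit quaternions is connected and contains the
  quaternion one.\<close>

lemma lmul_rotation:
  assumes "x \<in> S3" shows "rotation_matrix (lmul x)"
proof -
  have "det (lmul x) = 1"
  proof (rule connected_det_eq_1)
    show "connected (lmul ` S3)"
      using linear_lmul by (intro connected_continuous_image connected_sphere linear_continuous_on)
       (auto simp: linear_conv_bounded_linear)
    show "mat 1 \<in> lmul ` S3" using qone_S3 lmul_one by (metis imageI)
    show "det g = 1 \<or> det g = -1" if "g \<in> lmul ` S3" for g
      using that lmul_orthogonal det_orthogonal_matrix by (metis imageE)
  qed (use assms in blast)
  then show ?thesis using lmul_orthogonal[OF assms] by (simp add: rotation_matrix_def)
qed

text \<open>The element of \<^const>\<open>K4\<close> chosen to carry the base point \<^term>\<open>qone\<close> of the sphere to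
  \<open>x\<close>.  These elements lie in the identity component because \<open>x\<close> ranges over a connected sphere.\<close>

definition left_rotation :: "quat \<Rightarrow> mat5" where "left_rotation x = block_mat 1 0 0 (lmul x)"

lemma left_rotation_K4: "x \<in> S3 \<Longrightarrow> left_rotation x \<in> K4"
  using lmul_rotation by (auto simp: left_rotation_def K4_def)

lemma K4_form: assumes "k \<in> K4" shows "preserves_form k"
proof -
  obtain A where "k = block_mat 1 0 0 A" "transpose A ** A = mat 1"
    using assms by (auto simp: K4_def rotation_matrix_def orthogonal_matrix)
  then show ?thesis
    by (simp add: lorentz_form_def transpose_block_mat block_mat_mult)
      (simp add: vec_eq_iff outer_def matrix_matrix_mult_def vector_matrix_mult_def
        matrix_vector_mult_def mat_def if_distrib if_distribR sum_negf
       sum.delta cong: if_cong)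
qed

lemma left_rotation_base_null: "left_rotation x *v base_null = event 1 x"
  by (simp add: left_rotation_def base_null_def block_mat_event lmul_vec qmul_def vec4_eq_iff)

lemma left_rotation_G14: assumes "x \<in> S3" shows "left_rotation x \<in> G14"
proof (rule connected_imp_in_G14)
  have "linear (\<lambda>x. block_mat 0 0 0 (lmul x))"
    by (intro linearI)
     (simp_all add: block_mat_add scaleR_block_mat linear_add[OF linear_lmul] linear_cmul[OF linear_lmul])
  then have "continuous_on S3 (\<lambda>x. block_mat 1 0 0 0 + block_mat 0 0 0 (lmul x))"
    by (intro continuous_intros linear_continuous_on) (auto simp: linear_conv_bounded_linear)
  then have "continuous_on S3 left_rotation" by (simp add: block_mat_add left_rotation_def[abs_def])
  then show "connected (left_rotation ` S3)"
    by (intro connected_continuous_image connected_sphere) auto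
  show "mat 1 \<in> left_rotation ` S3" 
    using qone_S3 by (force simp: left_rotation_def lmul_one block_mat_1)
qed (use assms left_rotation_K4 K4_form in auto)

text \<open>For \<open>k\<close> in \<^const>\<open>K4\<close> with rotation block \<open>A\<close>, both sides are given by the first column of
  \<open>A\<close>.  This is the link between the adjoint orbit and the light cone.\<close>

lemma K4_Ad_Hel:
  assumes "k \<in> K4" shows "k *v base_null = event 1 (quat_of_mat (Ad k Hel))"
proof -
  note f = K4_form[OF assms]
  obtain A where k: "k = block_mat 1 0 0 A" and A: "transpose A ** A = mat 1"
    using assms by (auto simp: K4_def rotation_matrix_def orthogonal_matrix)
  let ?x = "A *v qone"
  have "?x v* A = (transpose A ** A) *v qone"
    by (simp only: matrix_vector_mul_assoc[symmetric] transpose_matrix_vector)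
  then have "block_mat 0 ?x ?x 0 ** k = k ** Hel"
    unfolding k Hel_def block_mat_mult A
    by simp
  then have "k ** Hel ** matrix_inv k = block_mat 0 ?x ?x 0"
    by (metis form_matrix_inv(3)[OF f] matrix_mul_assoc matrix_mul_rid)
  then have "quat_of_mat (Ad k Hel) = ?x"
    by (simp add: Ad_def quat_of_mat_def block_mat_def vec4_eq_iff)
  then show ?thesis by (simp add: k base_null_def block_mat_event)
qed

text \<open>Existence of the element of \<^const>\<open>K4\<close> in the coset comes from \<^const>\<open>left_rotation\<close>;
  uniqueness of the point holds because the elements of a coset send \<^const>\<open>base_null\<close> to the same
  line.\<close>

lemma flag_to_S3_coset:
  assumes g: "g \<in> G14" shows "flag_to_S3 (coset_P g) = sphere_point (g *v base_null)"
  unfolding flag_to_S3_def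
proof (rule the_equality)
  let ?x = "sphere_point (g *v base_null)"
  note n = sphere_point_of_null[OF G14_form[OF g] qone_S3, folded base_null_def]
  have k: "left_rotation ?x \<in> K4" "left_rotation ?x \<in> G14"
    using left_rotation_K4 left_rotation_G14 n(2) by auto
  have "g *v base_null = ((g *v base_null)$1) *\<^sub>R (left_rotation ?x *v base_null)"
    using n(3) by (simp add: left_rotation_base_null)
  then have "coset_P g = coset_P (left_rotation ?x)" by (rule coset_P_eqI[OF k(2) g])
  moreover have "?x = quat_of_mat (Ad (left_rotation ?x) Hel)"
    using K4_Ad_Hel[OF k(1)] by (simp add: left_rotation_base_null)
  ultimately show "\<exists>k\<in>K4. coset_P g = coset_P k \<and> ?x = quat_of_mat (Ad k Hel)" using k by blast
next
  fix x assume "\<exists>k\<in>K4. coset_P g = coset_P k \<and> x = quat_of_mat (Ad k Hel)"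
  then obtain k where k: "k \<in> K4" "coset_P g = coset_P k" and x: "x = quat_of_mat (Ad k Hel)" by blast
  have "k \<in> coset_P k" unfolding coset_P_def using mat1_in_P_min by force
  then obtain p c where p: "k = g ** p" "p \<in> G14" "p *v base_null = c *\<^sub>R base_null"
    unfolding k(2)[symmetric] by (auto simp: coset_P_def P_min_eq_line_stabilizer)
  have "c \<noteq> 0" using fixed_line_inv(1)[OF G14_form[OF p(2)] p(3)] .
  have "event 1 x = c *\<^sub>R (g *v base_null)"
    unfolding x K4_Ad_Hel[OF k(1), symmetric]
      by (simp add: p(1,3) matrix_vector_mult_scaleR flip: matrix_vector_mul_assoc)
  then show "x = sphere_point (g *v base_null)" by (metis sphere_point_event sphere_point_scaleR \<open>c \<noteq> 0\<close>)
qed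

text \<open>A coset over \<open>x\<close> has a representative \<open>h\<close> that sends \<^const>\<open>base_null\<close> to the line of
  \<^term>\<open>event 1 x\<close>, so \<open>g h\<close> sends it to the line of \<^term>\<open>g *v event 1 x\<close>.\<close>

lemma act_eq:
  assumes g: "g \<in> G14" and x: "x \<in> S3" shows "act g x = sphere_point (g *v event 1 x)"
proof -
  have "flag_to_S3 (coset_P (left_rotation x)) = x"
    using flag_to_S3_coset[OF left_rotation_G14[OF x]] by (simp add: left_rotation_base_null)
  then have im: "x \<in> flag_to_S3 ` flag" unfolding flag_def using left_rotation_G14[OF x] by (metis imageI)
  obtain h where h: "h \<in> G14" "inv_into flag flag_to_S3 x = coset_P h"
    using inv_into_into[OF im] by (auto simp: flag_def)
  have "sphere_point (h *v base_null) = x"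
    using f_inv_into_f[OF im] by (simp add: h flag_to_S3_coset)
  then have hv: "h *v base_null = ((h *v base_null)$1) *\<^sub>R event 1 x" "(h *v base_null)$1 \<noteq> 0"
    using sphere_point_of_null[OF G14_form[OF h(1)] qone_S3, folded base_null_def] by auto
  have "(\<lambda>h. g ** h) ` coset_P h = coset_P (g ** h)"
    by (auto simp: coset_P_def matrix_mul_assoc image_iff)
  then have "act g x = sphere_point (g *v (h *v base_null))"
    by (simp add: act_def h flag_to_S3_coset G14_mult g matrix_vector_mul_assoc)
  also have "\<dots> = sphere_point (((h *v base_null)$1) *\<^sub>R (g *v event 1 x))"
    by (subst hv(1)) (simp add: matrix_vector_mult_scaleR)
  also have "\<dots> = sphere_point (g *v event 1 x)" using hv(2) by (rule sphere_point_scaleR)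
  finally show ?thesis .
qed

section \<open>The exponential and the infinitesimal action\<close>

text \<open>The exponential of \<open>t T\<close> applied to a vector, for a linear map \<open>T\<close>.  Taking \<open>T\<close> to be left
  multiplication by a matrix and the vector to be the identity gives \<^const>\<open>mat_exp\<close>.\<close>

definition exp_series :: "('a::euclidean_space \<Rightarrow> 'a) \<Rightarrow> 'a \<Rightarrow> real \<Rightarrow> 'a" where
  "exp_series T v t = (\<Sum>n. (t ^ n / fact n) *\<^sub>R (T ^^ n) v)"

lemma exp_series_summable:
  fixes T :: "'a::euclidean_space \<Rightarrow> 'a"
  assumes "bounded_linear T"
  shows "summable (\<lambda>n. (t ^ n / fact n) *\<^sub>R (T ^^ n) v)"
proof -
  obtain K where K: "K > 0" "\<And>x. norm (T x) \<le> norm x * K"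
    using bounded_linear.pos_bounded[OF assms] by blast
  have bound: "norm ((T ^^ n) v) \<le> norm v * K ^ n" for n
  proof (induction n)
    case (Suc n)
    have "norm ((T ^^ Suc n) v) \<le> norm ((T ^^ n) v) * K" using K(2)[of "(T ^^ n) v"] by simp
    also have "\<dots> \<le> (norm v * K ^ n) * K" using Suc K(1) by (intro mult_right_mono) auto
    finally show ?case by (simp add: mult_ac)
  qed simp
  show ?thesis
  proof (rule summable_comparison_test')
    show "summable (\<lambda>n. norm v * (inverse (fact n) * (\<bar>t\<bar> * K) ^ n))"
      by (intro summable_mult summable_exp)
    show "norm ((t ^ n / fact n) *\<^sub>R (T ^^ n) v) \<le> norm v * (inverse (fact n) * (\<bar>t\<bar> * K) ^ n)"
      if "n \<ge> 0" for n
    proof -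
      have "norm ((t ^ n / fact n) *\<^sub>R (T ^^ n) v) = (\<bar>t\<bar> ^ n / fact n) * norm ((T ^^ n) v)"
        by (simp add: power_abs)
      also have "\<dots> \<le> (\<bar>t\<bar> ^ n / fact n) * (norm v * K ^ n)"
        by (intro mult_left_mono bound) auto
      finally show ?thesis by (simp add: power_mult_distrib field_simps)
    qed
  qed
qed

lemma exp_series_0: "exp_series T v 0 = v"
proof -
  have "exp_series T v 0 = (\<Sum>n\<in>{0}. (0 ^ n / fact n) *\<^sub>R (T ^^ n) v)"
    unfolding exp_series_def by (rule suminf_finite) auto
  then show ?thesis by simp
qed

text \<open>A derivative in a Euclidean space can be taken after pairing with a fixed vector \<open>b\<close>.  This turns
  the series into a real power series in \<open>t\<close>, which may be differentiated term by term.\<close>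

lemma exp_series_deriv:
  assumes T: "bounded_linear T"
  shows "(exp_series T v has_vector_derivative T (exp_series T v t)) (at t)"
proof -
  have ser: "f (exp_series T v s) = (\<Sum>n. f ((T ^^ n) v) / fact n * s ^ n)"
    "summable (\<lambda>n. f ((T ^^ n) v) / fact n * s ^ n)" if f: "bounded_linear f" for f :: "'a \<Rightarrow> real" and s
  proof -
    have eq: "f ((s ^ n / fact n) *\<^sub>R (T ^^ n) v) = f ((T ^^ n) v) / fact n * s ^ n" for n
      by (simp add: linear_cmul[OF bounded_linear.linear[OF f]])
    show "f (exp_series T v s) = (\<Sum>n. f ((T ^^ n) v) / fact n * s ^ n)"
      unfolding exp_series_def bounded_linear.suminf[OF f exp_series_summable[OF T]] eq ..
    show "summable (\<lambda>n. f ((T ^^ n) v) / fact n * s ^ n)"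
      using bounded_linear.summable[OF f exp_series_summable[OF T, of s v]] unfolding eq .
  qed
  have "((\<lambda>s. exp_series T v s \<bullet> b) has_vector_derivative T (exp_series T v t) \<bullet> b) (at t)" for b
  proof -
    have b: "bounded_linear (\<lambda>x. x \<bullet> b)" by (rule bounded_linear_inner_left)
    have Tb: "bounded_linear (\<lambda>x. T x \<bullet> b)" by (rule bounded_linear_compose[OF b T])
    have "diffs (\<lambda>n. (T ^^ n) v \<bullet> b / fact n) n = T ((T ^^ n) v) \<bullet> b / fact n" for n
      by (simp add: diffs_def del: of_nat_Suc)
    then have "(\<Sum>n. diffs (\<lambda>n. (T ^^ n) v \<bullet> b / fact n) n * t ^ n) = T (exp_series T v t) \<bullet> b"
      using ser(1)[OF Tb] by simp
    moreover have "((\<lambda>s. \<Sum>n. (T ^^ n) v \<bullet> b / fact n * s ^ n) has_field_derivative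
        (\<Sum>n. diffs (\<lambda>n. (T ^^ n) v \<bullet> b / fact n) n * t ^ n)) (at t)"
      by (rule termdiffs_strong_converges_everywhere) (rule ser(2)[OF b])
    ultimately show ?thesis
      unfolding ser(1)[OF b] has_real_derivative_iff_has_vector_derivative by simp
  qed
  then show ?thesis
    unfolding has_vector_derivative_def
    by (subst has_derivative_componentwise_within) simp
qed

lemma bounded_bilinear_matrix_mult:
  "bounded_bilinear ((**) :: real^'n^'m \<Rightarrow> real^'p^'n \<Rightarrow> real^'p^'m)"
  unfolding bilinear_conv_bounded_bilinear[symmetric] bilinear_def
  by (intro conjI allI linearI)
    (simp_all add: matrix_matrix_mult_def vec_eq_iff sum_distrib_left sum.distrib algebra_simps)

lemma mat_exp_series: "mat_exp (t *\<^sub>R Y) = exp_series ((**) Y) (mat 1) t"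
proof -
  have "((**) (t *\<^sub>R Y) ^^ n) (mat 1) = t ^ n *\<^sub>R ((**) Y ^^ n) (mat 1)" for n
    by (induction n)
      (simp_all add: bounded_bilinear.scaleR_left[OF bounded_bilinear_matrix_mult]
        bounded_bilinear.scaleR_right[OF bounded_bilinear_matrix_mult] mult_ac)
  then show ?thesis by (simp add: mat_exp_def exp_series_def field_simps)
qed

lemma mat_exp_0: "mat_exp (0 *\<^sub>R Y) = mat 1"
  by (simp only: mat_exp_series exp_series_0)

lemma mat_exp_deriv:
  "((\<lambda>t. mat_exp (t *\<^sub>R Y)) has_vector_derivative Y ** mat_exp (t *\<^sub>R Y)) (at t)"
  unfolding mat_exp_series
  by (rule exp_series_deriv[OF bounded_bilinear.bounded_linear_right[OF bounded_bilinear_matrix_mult]])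

lemma bounded_linear_transpose: "bounded_linear (transpose :: real^'n^'m \<Rightarrow> real^'m^'n)"
  unfolding linear_conv_bounded_linear[symmetric]
  by (intro linearI) (simp_all add: transpose_add transpose_scalar)

text \<open>The curve \<open>E\<^sup>T J E\<close>, with \<open>E\<close> the exponential and \<open>J\<close> the form, has derivative
  \<open>E\<^sup>T (Y\<^sup>T J + J Y) E = 0\<close> and is therefore constant.\<close>

lemma mat_exp_preserves_form:
  assumes Y: "Y \<in> so14" shows "preserves_form (mat_exp (t *\<^sub>R Y))"
proof -
  let ?E = "\<lambda>t. mat_exp (t *\<^sub>R Y)"
  let ?F = "\<lambda>t. transpose (?E t) ** lorentz_form ** ?E t"
  note bil = bounded_bilinear.has_vector_derivative[OF bounded_bilinear_matrix_mult]
  have "(?F has_vector_derivative 0) (at s within UNIV)" for s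
  proof -
    have "(?F has_vector_derivative
      transpose (?E s) ** lorentz_form ** (Y ** ?E s) +
      (transpose (?E s) ** 0 + transpose (Y ** ?E s) ** lorentz_form) ** ?E s) (at s)"
      by (intro bil mat_exp_deriv bounded_linear.has_vector_derivative[OF bounded_linear_transpose]
        has_vector_derivative_const)
    also have "transpose (?E s) ** lorentz_form ** (Y ** ?E s) +
      (transpose (?E s) ** 0 + transpose (Y ** ?E s) ** lorentz_form) ** ?E s
      = transpose (?E s) ** (transpose Y ** lorentz_form + lorentz_form ** Y) ** ?E s"
      by (simp add: matrix_add_ldistrib matrix_add_rdistrib matrix_transpose_mul matrix_mul_assoc
        add.commute)
    also have "\<dots> = 0" using Y by (simp add: so14_iff)
    finally show ?thesis by simp
  qed
  then obtain c where "\<And>s. s \<in> UNIV \<Longrightarrow> ?F s = c"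
    using has_vector_derivative_zero_constant[of UNIV ?F] by auto
  then have "?F t = ?F 0" by (metis UNIV_I)
  then show ?thesis unfolding mat_exp_0 by (simp add: transpose_mat)
qed

lemma mat_exp_G14:
  assumes "Y \<in> so14" shows "mat_exp (t *\<^sub>R Y) \<in> G14"
proof (rule connected_imp_in_G14)
  have "continuous_on UNIV (\<lambda>t. mat_exp (t *\<^sub>R Y))"
    by (intro continuous_at_imp_continuous_on ballI) (rule has_vector_derivative_continuous[OF
      mat_exp_deriv])
  then show "connected (range (\<lambda>t. mat_exp (t *\<^sub>R Y)))"
    by (rule connected_continuous_image) simp
  show "mat 1 \<in> range (\<lambda>t. mat_exp (t *\<^sub>R Y))" using mat_exp_0[of Y] by (metis rangeI)
qed (use mat_exp_preserves_form[OF assms] in auto)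

text \<open>The derivative of the quotient \<^term>\<open>sphere_point\<close> at \<^term>\<open>event 1 x\<close> in the direction
  \<^term>\<open>Y *v event 1 x\<close>.  The formula is linear in \<open>Y\<close>, on all matrices.\<close>

definition action_field :: "mat5 \<Rightarrow> quat \<Rightarrow> quat" where
  "action_field Y = on_S3 (\<lambda>x. space_part (Y *v event 1 x) - ((Y *v event 1 x)$1) *\<^sub>R x)"

lemma inf_action_eq_action_field:
  assumes Y: "Y \<in> so14" shows "inf_action Y = action_field Y"
proof -
  have "vector_derivative (\<lambda>t. act (mat_exp (t *\<^sub>R Y)) x) (at 0)
      = space_part (Y *v event 1 x) - ((Y *v event 1 x)$1) *\<^sub>R x" if x: "x \<in> S3" for x
  proof -
    define u where "u t = mat_exp (t *\<^sub>R Y) *v event 1 x" for t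
    have u0: "u 0 = event 1 x" unfolding u_def mat_exp_0 by simp
    have "linear (\<lambda>A. A *v event 1 x)"
      by (intro linearI) (simp_all add: matrix_vector_mult_add_rdistrib scaleR_matrix_vector_assoc)
    then have "bounded_linear (\<lambda>A. A *v event 1 x)" by (simp add: linear_conv_bounded_linear)
    from bounded_linear.has_vector_derivative[OF this mat_exp_deriv[of Y 0]]
    have u': "(u has_vector_derivative Y *v event 1 x) (at 0)"
      unfolding u_def[abs_def] mat_exp_0 by simp
    have 1: "((\<lambda>t. u t $ 1) has_field_derivative (Y *v event 1 x) $ 1) (at 0)"
      unfolding has_real_derivative_iff_has_vector_derivative
      by (rule bounded_linear.has_vector_derivative[OF bounded_linear_vec_nth u'])
    have 2: "((\<lambda>t. space_part (u t)) has_vector_derivative space_part (Y *v event 1 x)) (at 0)"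
      by (rule bounded_linear.has_vector_derivative[OF _ u'])
        (use linear_space_part in \<open>simp add: linear_conv_bounded_linear\<close>)
    have "((\<lambda>t. inverse (u t $ 1)) has_field_derivative - ((Y *v event 1 x) $ 1)) (at 0)"
      using DERIV_inverse'[OF 1] by (simp add: u0)
    from has_vector_derivative_scaleR[OF this 2]
    have "((\<lambda>t. sphere_point (u t)) has_vector_derivative
       space_part (Y *v event 1 x) - ((Y *v event 1 x) $ 1) *\<^sub>R x) (at 0)"
      by (simp add: sphere_point_def u0)
    moreover have "act (mat_exp (t *\<^sub>R Y)) x = sphere_point (u t)" for t
      using act_eq[OF mat_exp_G14[OF Y] x] by (simp add: u_def)
    ultimately show ?thesis by (simp add: vector_derivative_at)
  qed
  then show ?thesis by (auto simp: inf_action_def action_field_def on_S3_def fun_eq_iff)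
qed

lemma action_field_block: "action_field (block_mat 0 b b D) = on_S3 (\<lambda>x. b + D *v x - (b \<bullet> x) *\<^sub>R x)"
  by (simp add: action_field_def block_mat_event)

lemma linear_action_field: "Vector_Spaces.linear (*\<^sub>R) vf_scale action_field"
  by unfold_locales
    (auto simp: action_field_def on_S3_def fun_eq_iff vf_scale_def matrix_vector_mult_add_rdistrib
      algebra_simps
      linear_add[OF linear_space_part] linear_cmul[OF linear_space_part] simp flip:
        scaleR_matrix_vector_assoc)

lemma matrix_vector_axis: "(D *v axis i 1) $ j = (D::real^4^4) $ j $ i"
  by (simp add: matrix_vector_mult_basis column_def)

text \<open>Evaluation at a unit coordinate vector and at its negative separates the part \<open>D x\<close>, odd in
  \<open>x\<close>, from the even part.  The odd parts give the columns of \<open>D\<close>; the even parts say that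
  \<open>b\<close> is a multiple of each coordinate vector.\<close>

lemma action_field_injective:
  assumes Y: "Y \<in> so14" and 0: "action_field Y = 0" shows "Y = 0"
proof -
  obtain b D where Yb: "Y = block_mat 0 b b D" using Y by (auto simp: so14_def)
  have z: "b + D *v x - (b \<bullet> x) *\<^sub>R x = 0" if "x \<in> S3" for x
    using fun_cong[OF 0, of x] that by (simp add: Yb action_field_block on_S3_def)
  have z1: "b$j + D$j$i = b$i * axis i 1 $ j" "b$j - D$j$i = b$i * axis i 1 $ j" for i j
  proof -
    have "axis i 1 \<in> S3" "- axis i 1 \<in> S3" by simp_all
    from this[THEN z] have "(b + D *v axis i 1 - (b \<bullet> axis i 1) *\<^sub>R axis i 1) $ j = 0"
      "(b + D *v (- axis i 1) - (b \<bullet> (- axis i 1)) *\<^sub>R (- axis i 1)) $ j = 0" by simp_all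
    then show "b$j + D$j$i = b$i * axis i 1 $ j" "b$j - D$j$i = b$i * axis i 1 $ j"
      by (simp_all add: inner_axis matrix_vector_axis vec.neg)
  qed
  have "D$j$i = 0" for i j using z1[of j i] by linarith
  then have D: "D = 0" by (simp add: vec_eq_iff)
  have "b$j = 0" for j :: 4
  proof -
    obtain i :: 4 where "i \<noteq> j" by (metis exhaust_4 one_neq_zero zero_neq_one)
    then show ?thesis using z1(1)[of j i] by (simp add: D axis_def)
  qed
  then have "b = 0" by (simp add: vec_eq_iff)
  then show ?thesis by (simp add: Yb D block_mat_0)
qed

section \<open>The fields in quaternionic form\<close>

lemma quat_conj_sandwich: "x \<odot> qcnj q \<odot> x = (2 * (q \<bullet> x)) *\<^sub>R x - (x \<bullet> x) *\<^sub>R q"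
  by (simp add: qmul_def qcnj_def vec4_eq_iff inner_4 algebra_simps)

lemma X_field_eq_action_field: "X_field q z w = action_field (block_mat 0 q q (lmul z + rmul w))"
proof -
  have "(1/2) *\<^sub>R (q - x \<odot> qcnj q \<odot> x) = q - (q \<bullet> x) *\<^sub>R x" if "x \<in> S3" for x
  proof -
    have "x \<bullet> x = 1" using that by (simp add: norm_eq_1)
    then show ?thesis by (simp add: quat_conj_sandwich vec_eq_iff algebra_simps)
  qed
  then show ?thesis
    by (auto simp: X_field_def action_field_block on_S3_def fun_eq_iff lmul_vec rmul_vec
      matrix_vector_mult_add_rdistrib)
qed

lemma lmul_rmul_skew:
  assumes "z \<in> ImH" "w \<in> ImH" shows "transpose (lmul z + rmul w) = - (lmul z + rmul w)"
  using assms by (simp add: ImH_def lmul_def rmul_def qmul_def axis_def transpose_def vec4_eq_iff)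

text \<open>The decomposition of \<open>so(4)\<close> into two copies of \<open>su(2)\<close>.  Left and right multiplication by an
  imaginary unit agree in the first column and have opposite signs in the complementary entry, so
  the two parts are recovered as half sums and half differences.\<close>

lemma skew_eq_lmul_rmul:
  assumes "transpose D = - D"
  obtains z w where "z \<in> ImH" "w \<in> ImH" "D = lmul z + rmul w"
proof
  \<comment> \<open>The entries (2,1), (3,1), (4,1) of the matrix are the sums \<open>z\<^sub>i + w\<^sub>i\<close>, and the entries
    (3,4), (4,2), (2,3) are the differences \<open>w\<^sub>i - z\<^sub>i\<close>.\<close>
  let ?z = "vector [0, (D$2$1 - D$3$4) / 2, (D$3$1 - D$4$2) / 2, (D$4$1 - D$2$3) / 2] :: quat"
  let ?w = "vector [0, (D$2$1 + D$3$4) / 2, (D$3$1 + D$4$2) / 2, (D$4$1 + D$2$3) / 2] :: quat"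
  have skew: "D$j$i = - (D$i$j)" for i j
    using arg_cong[OF assms, of "\<lambda>A. A$i$j"] by (simp add: transpose_def)
  have d: "D$1$1 = 0" "D$2$2 = 0" "D$3$3 = 0" "D$4$4 = 0"
    using skew[of 1 1] skew[of 2 2] skew[of 3 3] skew[of 4 4] by linarith+
  show "?z \<in> ImH" "?w \<in> ImH" by (simp_all add: ImH_def)
  show "D = lmul ?z + rmul ?w"
    using d skew[of 2 1] skew[of 3 1] skew[of 4 1] skew[of 3 4] skew[of 4 2] skew[of 2 3]
    by (simp add: lmul_def rmul_def qmul_def axis_def vec4_eq_iff field_simps)
qed

lemma lmul_rmul_zero:
  assumes "z \<in> ImH" "w \<in> ImH" "lmul z + rmul w = 0" shows "z = 0 \<and> w = 0"
proof -
  have z1: "z$1 = 0" "w$1 = 0" using assms by (simp_all add: ImH_def)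
  have 0: "lmul z $ i $ j + rmul w $ i $ j = 0" for i j
    using arg_cong[OF assms(3), of "\<lambda>A. A$i$j"] by simp
  have "z$2 + w$2 = 0" "z$3 + w$3 = 0" "z$4 + w$4 = 0"
    using 0[of 2 1] 0[of 3 1] 0[of 4 1] by (simp_all add: lmul_def rmul_def qmul_def axis_def)
  moreover have "w$2 - z$2 = 0" "w$3 - z$3 = 0" "w$4 - z$4 = 0"
    using 0[of 3 4] 0[of 4 2] 0[of 2 3] by (simp_all add: lmul_def rmul_def qmul_def axis_def)
  ultimately show ?thesis by (simp add: z1 vec4_eq_iff)
qed

lemma X_space_eq_action_fields: "X_space = action_field ` so14"
proof
  show "X_space \<subseteq> action_field ` so14"
    using lmul_rmul_skew by (fastforce simp: X_space_def X_field_eq_action_field so14_def)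
  show "action_field ` so14 \<subseteq> X_space"
  proof
    fix V assume "V \<in> action_field ` so14"
    then obtain b D where V: "V = action_field (block_mat 0 b b D)" "transpose D = - D"
      by (auto simp: so14_def)
    from V(2) obtain z w where zw: "z \<in> ImH" "w \<in> ImH" "D = lmul z + rmul w" by (rule skew_eq_lmul_rmul)
    have "V = X_field b z w" by (simp add: V(1) zw(3) X_field_eq_action_field)
    then show "V \<in> X_space" using zw unfolding X_space_def by blast
  qed
qed

section \<open>The bracket of the fields\<close>

text \<open>The derivative at \<open>x\<close> of the radial retraction onto the sphere is the orthogonal projection onto the
  tangent space, so on tangent vectors the chain rule leaves the derivative of the polynomial
  \<open>b + D x - (b \<bullet> x) x\<close>.\<close>

lemma S3_deriv_action_field:
  assumes x: "x \<in> S3" and u: "x \<bullet> u = 0"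
  shows "S3_deriv (action_field (block_mat 0 b b D)) x u = D *v u - (b \<bullet> u) *\<^sub>R x - (b \<bullet> x) *\<^sub>R u"
proof -
  let ?n = "\<lambda>y::quat. y /\<^sub>R norm y" and ?V = "\<lambda>y. b + D *v y - (b \<bullet> y) *\<^sub>R y"
  have nx: "norm x = 1" using x by simp
  then have "x \<noteq> 0" by auto
  have n: "(?n has_derivative (\<lambda>h. h - (x \<bullet> h) *\<^sub>R x)) (at x)"
  proof -
    have "(norm has_derivative (\<lambda>h. x \<bullet> h)) (at x)"
      using has_derivative_norm[OF \<open>x \<noteq> 0\<close>] nx by (simp add: sgn_div_norm inner_commute)
    from Deriv.has_derivative_inverse[OF _ this] nx
    have "((\<lambda>y. inverse (norm y)) has_derivative (\<lambda>h. - (x \<bullet> h))) (at x)" by simp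
    from has_derivative_scaleR[OF this has_derivative_ident] show ?thesis
      by (simp add: nx)
  qed
  have "bounded_linear ((*v) D)" by (rule matrix_vector_mul_bounded_linear)
  note D = bounded_linear.has_derivative[OF this has_derivative_ident]
  have "((\<lambda>y. (b \<bullet> y) *\<^sub>R y) has_derivative (\<lambda>h. (b \<bullet> x) *\<^sub>R h + (b \<bullet> h) *\<^sub>R x)) (at x)"
    by (intro has_derivative_scaleR has_derivative_inner_right has_derivative_ident)
  from has_derivative_diff[OF has_derivative_add[OF has_derivative_const D] this]
  have V: "(?V has_derivative (\<lambda>h. D *v h - ((b \<bullet> x) *\<^sub>R h + (b \<bullet> h) *\<^sub>R x))) (at (?n x))"
    by (simp add: nx)
  have "((\<lambda>y. ?V (?n y)) has_derivative
     (\<lambda>h. D *v (h - (x \<bullet> h) *\<^sub>R x) - ((b \<bullet> x) *\<^sub>R (h - (x \<bullet> h) *\<^sub>R x) + (b \<bullet> (h - (x \<bullet> h) *\<^sub>R x))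
       *\<^sub>R x))) (at x)"
    by (rule has_derivative_compose[OF n V])
  then have "((\<lambda>y. action_field (block_mat 0 b b D) (?n y)) has_derivative
     (\<lambda>h. D *v (h - (x \<bullet> h) *\<^sub>R x) - ((b \<bullet> x) *\<^sub>R (h - (x \<bullet> h) *\<^sub>R x) + (b \<bullet> (h - (x \<bullet> h) *\<^sub>R x))
       *\<^sub>R x))) (at x)"
    by (rule has_derivative_transform_within_open[of _ _ _ _ "- {0}"])
      (use \<open>x \<noteq> 0\<close> in \<open>auto simp: action_field_block on_S3_def\<close>)
  from frechet_derivative_at[OF this, symmetric] show ?thesis
    by (simp add: S3_deriv_def u)
qed

lemma vector_matrix_skew: "transpose D = - D \<Longrightarrow> b v* D = - (D *v (b::quat))"
  using transpose_matrix_vector[of D b]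
  by (simp add: matrix_vector_mult_def vec_eq_iff sum_negf)

lemma outer_vec: "outer c b *v x = (b \<bullet> x) *\<^sub>R c"
  by (simp add: outer_def vec_eq_iff matrix_vector_mult_def inner_vec_def sum_distrib_left mult_ac)

lemma mat_bracket_block:
  assumes "transpose D = - D" "transpose E = - E"
  shows "mat_bracket (block_mat 0 b b D) (block_mat 0 c c E) =
    block_mat 0 (D *v c - E *v b) (D *v c - E *v b) (outer b c - outer c b + D ** E - E ** D)"
  unfolding mat_bracket_def block_mat_mult block_mat_diff
  by (simp add: inner_commute vector_matrix_skew[OF assms(1)] vector_matrix_skew[OF assms(2)])

lemma mat_bracket_so14: 
  assumes "Y \<in> so14" "Z \<in> so14" shows "mat_bracket Y Z \<in> so14"
proof -
  obtain b D c E where Y: "Y = block_mat 0 b b D" "transpose D = - D"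
    and Z: "Z = block_mat 0 c c E" "transpose E = - E" using assms by (auto simp: so14_def)
  have o: "transpose (outer b c) = outer c b" for b c by (simp add: outer_def transpose_def vec_eq_iff)
  have m: "(-A) ** (-B) = A ** (B :: real^4^4)" for A B
    by (simp add: matrix_matrix_mult_def vec_eq_iff)
  have d: "transpose (A - B) = transpose A - transpose (B::real^4^4)" for A B
    by (simp add: transpose_def vec_eq_iff)
  have "transpose (outer b c - outer c b + D ** E - E ** D) = - (outer b c - outer c b + D ** E - E ** D)"
    by (simp add: transpose_add d o matrix_transpose_mul Y Z m)
  then show ?thesis unfolding Y Z mat_bracket_block[OF Y(2) Z(2)] so14_def by blast
qed

text \<open>The fields generated by a left action reverse the bracket, whence the sign.\<close>

lemma vf_bracket_action_field:
  assumes "Y \<in> so14" "Z \<in> so14"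
  shows "vf_bracket (action_field Y) (action_field Z) = action_field (- mat_bracket Y Z)"
proof -
  obtain b D c E where Y: "Y = block_mat 0 b b D" "transpose D = - D"
    and Z: "Z = block_mat 0 c c E" "transpose E = - E" using assms by (auto simp: so14_def)
  have skew: "v \<bullet> (A *v x) = - ((A *v v) \<bullet> x)" if "transpose A = - A" for A :: "real^4^4" and v x
    using vector_matrix_skew[OF that, of v] dot_lmul_matrix[of v A x] by simp
  have sk0: "x \<bullet> (A *v x) = 0" if "transpose A = - A" for A :: "real^4^4" and x
    using skew[OF that, of x x] by (simp add: inner_commute)
  have tangent: "x \<bullet> (a + A *v x - (a \<bullet> x) *\<^sub>R x) = 0" if "x \<in> S3" "transpose A = - A" for x a A
    using that(1) by (simp add: inner_diff_right inner_add_right sk0[OF that(2)] norm_eq_1 inner_commute)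
  have "S3_deriv (action_field Z) x (action_field Y x) - S3_deriv (action_field Y) x (action_field
    Z x) = action_field (- mat_bracket Y Z) x"
    if x: "x \<in> S3" for x
  proof -
    let ?V = "b + D *v x - (b \<bullet> x) *\<^sub>R x" and ?W = "c + E *v x - (c \<bullet> x) *\<^sub>R x"
    have 1: "action_field Y x = ?V" "action_field Z x = ?W" using x
      by (simp_all add: Y Z action_field_block on_S3_def)
    have 2: "S3_deriv (action_field Z) x ?V = E *v ?V - (c \<bullet> ?V) *\<^sub>R x - (c \<bullet> x) *\<^sub>R ?V"
      "S3_deriv (action_field Y) x ?W = D *v ?W - (b \<bullet> ?W) *\<^sub>R x - (b \<bullet> x) *\<^sub>R ?W"
      unfolding Y(1) Z(1) by (intro S3_deriv_action_field x tangent Y(2) Z(2))+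
    have "- mat_bracket Y Z = block_mat 0 (E *v b - D *v c) (E *v b - D *v c) (outer c b - outer b
      c + E ** D - D ** E)"
      unfolding Y(1) Z(1) mat_bracket_block[OF Y(2) Z(2)]
      using scaleR_block_mat[of "-1"] by simp
    then have 3: "action_field (- mat_bracket Y Z) x = E *v b - D *v c + ((b \<bullet> x) *\<^sub>R c - (c \<bullet> x)
      *\<^sub>R b + E *v (D *v x) - D *v (E *v x))
        - ((E *v b - D *v c) \<bullet> x) *\<^sub>R x"
      using x by (simp add: action_field_block on_S3_def matrix_vector_mult_add_rdistrib
        matrix_vector_mult_diff_rdistrib outer_vec matrix_vector_mul_assoc)
    have 4: "c \<bullet> ?V = c \<bullet> b - (D *v c) \<bullet> x - (b \<bullet> x) * (c \<bullet> x)"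
      "b \<bullet> ?W = c \<bullet> b - (E *v b) \<bullet> x - (b \<bullet> x) * (c \<bullet> x)"
      using skew[OF Y(2), of c x] skew[OF Z(2), of b x] inner_commute[of b c]
      by (simp_all add: inner_diff_right inner_add_right)
    have 5: "E *v ?V = E *v b + E *v (D *v x) - (b \<bullet> x) *\<^sub>R (E *v x)"
      "D *v ?W = D *v c + D *v (E *v x) - (c \<bullet> x) *\<^sub>R (D *v x)"
      by (simp_all add: matrix_vector_right_distrib matrix_vector_mult_diff_distrib
        matrix_vector_mult_scaleR)
    show ?thesis unfolding 1 2 3 4 5 by (simp add: algebra_simps)
  qed
  then show ?thesis by (auto simp: vf_bracket_def on_S3_def fun_eq_iff action_field_def)
qed

section \<open>The Lie algebra of fields\<close>

text \<open>The change of sign turns the antihomomorphism \<^const>\<open>action_field\<close> into a homomorphism.\<close>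

definition opposite_field :: "mat5 \<Rightarrow> quat \<Rightarrow> quat" where
  "opposite_field Y = action_field (- Y)"

lemma linear_opposite_field: "Vector_Spaces.linear (*\<^sub>R) vf_scale opposite_field"
proof -
  interpret action_field: Vector_Spaces.linear "(*\<^sub>R)" vf_scale action_field by (rule linear_action_field)
  show ?thesis
    by unfold_locales (simp_all add: opposite_field_def action_field.neg action_field.add
      action_field.diff action_field.scale)
qed

lemma X_space_eq_opposite_fields: "X_space = opposite_field ` so14"
proof -
  have "uminus ` so14 = so14"
    using subspace_neg[OF subspace_so14] by (force simp: image_iff intro: bexI[of _ "- _"])
  then show ?thesis unfolding X_space_eq_action_fields opposite_field_def by (metis image_image)
qed

lemma inj_opposite_field: "inj_on opposite_field so14"
proof (rule inj_onI)
  interpret a: Vector_Spaces.linear "(*\<^sub>R)" vf_scale opposite_field by (rule linear_opposite_field)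
  fix Y Z assume YZ: "Y \<in> so14" "Z \<in> so14" "opposite_field Y = opposite_field Z"
  then have "action_field (Z - Y) = 0" using a.diff[of Y Z] by (simp add: opposite_field_def)
  then show "Y = Z" using action_field_injective[of "Z - Y"] subspace_diff[OF subspace_so14] YZ by simp
qed

lemma vf_bracket_opposite_field:
  assumes "Y \<in> so14" "Z \<in> so14"
  shows "vf_bracket (opposite_field Y) (opposite_field Z) = opposite_field (mat_bracket Y Z)"
proof -
  have "mat_bracket (- Y) (- Z) = mat_bracket Y Z"
    by (simp add: mat_bracket_def matrix_matrix_mult_def vec_eq_iff)
  then show ?thesis
    unfolding opposite_field_def using vf_bracket_action_field[of "- Y" "- Z"] assms
      subspace_neg[OF subspace_so14] by simp
qed

lemma lie_algebra_so14: "lie_algebra (*\<^sub>R) so14 mat_bracket"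
proof unfold_locales
  interpret m: bounded_bilinear "(**) :: mat5 \<Rightarrow> mat5 \<Rightarrow> mat5" by (rule bounded_bilinear_matrix_mult)
  show "module.subspace (*\<^sub>R) so14" using subspace_so14 by (simp add: subspace_raw_def)
  fix x y z :: mat5 and c :: real
  show "x \<in> so14 \<Longrightarrow> y \<in> so14 \<Longrightarrow> mat_bracket x y \<in> so14" by (rule mat_bracket_so14)
  show "mat_bracket (x + y) z = mat_bracket x z + mat_bracket y z"
    "mat_bracket x (y + z) = mat_bracket x y + mat_bracket x z"
    "mat_bracket (c *\<^sub>R x) y = c *\<^sub>R mat_bracket x y"
    "mat_bracket x (c *\<^sub>R y) = c *\<^sub>R mat_bracket x y"
    "mat_bracket x x = 0"
    "mat_bracket x (mat_bracket y z) + mat_bracket y (mat_bracket z x) + mat_bracket z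
      (mat_bracket x y) = 0"
    by (simp_all add: mat_bracket_def m.add_left m.add_right m.diff_left m.diff_right
      m.scaleR_left m.scaleR_right
      scaleR_diff_right matrix_mul_assoc)
qed

text \<open>Every axiom for \<open>br'\<close> on the image is the image under \<open>f\<close> of the axiom for \<open>br\<close>.\<close>

lemma lie_algebra_image:
  assumes L: "lie_algebra sc L br" and f: "Vector_Spaces.linear sc sc' f"
    and br': "\<And>x y. x \<in> L \<Longrightarrow> y \<in> L \<Longrightarrow> br' (f x) (f y) = f (br x y)"
  shows "lie_algebra sc' (f ` L) br'"
proof -
  interpret L: lie_algebra sc L br by fact
  interpret f: Vector_Spaces.linear sc sc' f by fact
  note cl = L.subspace_add[OF L.carrier_subspace] L.subspace_scale[OF L.carrier_subspace] L.br_closed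
  show ?thesis
  proof unfold_locales
    show "f.vs2.subspace (f ` L)" by (rule f.subspace_image[OF L.carrier_subspace])
  next
    fix x y assume "x \<in> f ` L" "y \<in> f ` L"
    then show "br' x y \<in> f ` L" using br' L.br_closed by auto
  next
    fix x y z assume "x \<in> f ` L" "y \<in> f ` L" "z \<in> f ` L"
    then obtain a b c where [simp]: "x = f a" "y = f b" "z = f c" and abc: "a \<in> L" "b \<in> L" "c \<in> L" by auto
    show "br' (x + y) z = br' x z + br' y z"
      using abc by (simp add: br' cl L.br_add_left flip: f.add)
    show "br' x (y + z) = br' x y + br' x z"
      using abc by (simp add: br' cl L.br_add_right flip: f.add)
    show "br' x (br' y z) + br' y (br' z x) + br' z (br' x y) = 0"
      using abc L.jacobi[OF abc] by (simp add: br' cl flip: f.add)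
  next
    fix x y c assume "x \<in> f ` L" "y \<in> f ` L"
    then obtain a b where [simp]: "x = f a" "y = f b" and ab: "a \<in> L" "b \<in> L" by auto
    show "br' (sc' c x) y = sc' c (br' x y)"
      using ab by (simp add: br' cl L.br_scale_left flip: f.scale)
    show "br' x (sc' c y) = sc' c (br' x y)"
      using ab by (simp add: br' cl L.br_scale_right flip: f.scale)
  next
    fix x assume "x \<in> f ` L"
    then show "br' x x = 0" using br' L.br_self by auto
  qed
qed

lemma X_space_lie_algebra: "lie_algebra vf_scale X_space vf_bracket"
  unfolding X_space_eq_opposite_fields
  by (rule lie_algebra_image[OF lie_algebra_so14 linear_opposite_field vf_bracket_opposite_field])

definition imag_quat :: "real^3 \<Rightarrow> quat" where "imag_quat z = vector [0, z$1, z$2, z$3]"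

lemma linear_imag_quat: "linear imag_quat"
  by (intro linearI) (simp_all add: imag_quat_def vec4_eq_iff)

lemma imag_quat_ImH: "imag_quat z \<in> ImH" by (simp add: imag_quat_def ImH_def)

lemma ImH_eq_range_imag_quat: "ImH = range imag_quat"
proof -
  have "x = imag_quat (vector [x$2, x$3, x$4])" if "x$1 = 0" for x
    using that by (simp add: imag_quat_def vec4_eq_iff)
  then show ?thesis using imag_quat_ImH by (auto simp: ImH_def)
qed

text \<open>The parameters \<open>(q, z, w)\<close> range over a space of dimension 4 + 3 + 3 and map linearly and
  injectively to the fields, so a basis of the parameters is carried to a basis of the fields.\<close>

lemma dim_X_space: "vf.dim X_space = 10"
proof -
  \<comment> \<open>Imaginary quaternions are written as vectors of \<open>real^3\<close>, so that the parameter space is a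
    Euclidean space with a standard basis.\<close>
  define M where "M = (\<lambda>(q, z, w). block_mat 0 q q (lmul (imag_quat z) + rmul (imag_quat w)))"
  define T where "T = action_field \<circ> M"
  have M: "linear M"
    by (intro linearI)
      (auto simp: M_def block_mat_add scaleR_block_mat scaleR_add_right linear_add[OF
        linear_imag_quat] linear_cmul[OF linear_imag_quat]
       linear_add[OF linear_lmul] linear_cmul[OF linear_lmul] linear_add[OF linear_rmul]
         linear_cmul[OF linear_rmul])
  have T: "Vector_Spaces.linear (*\<^sub>R) vf_scale T"
    unfolding T_def using M linear_action_field
      by (intro Vector_Spaces.linear_compose) (simp_all add: linear_def real_scaleR_def)
  interpret T: Vector_Spaces.linear "(*\<^sub>R)" vf_scale T by (rule T)
  have M_so14: "M p \<in> so14" for p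
    unfolding M_def so14_def using lmul_rmul_skew imag_quat_ImH by (auto split: prod.splits)
  have "p = 0" if "T p = 0" for p
  proof -
    have "M p = 0" using action_field_injective[OF M_so14] that by (simp add: T_def)
    then obtain q z w where p: "p = (q, z, w)" and "q = 0" and 0: "lmul (imag_quat z) + rmul
      (imag_quat w) = 0"
      by (cases p) (simp add: M_def flip: block_mat_0)
    moreover have "imag_quat z = 0 \<and> imag_quat w = 0"
      using lmul_rmul_zero[OF imag_quat_ImH imag_quat_ImH 0] .
    ultimately show ?thesis by (simp add: imag_quat_def vec4_eq_iff vec_eq_iff forall_3 zero_prod_def)
  qed
  then have inj: "inj T" using T.inj_iff_eq_0 by blast
  have "X_space = range T"
    by (auto simp: X_space_def X_field_eq_action_field T_def M_def ImH_eq_range_imag_quat image_iff) blast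
  also have "\<dots> = T ` span Basis" by simp
  also have "\<dots> = vf.span (T ` Basis)" by (simp only: T.span_image span_raw_def)
  finally have sp: "X_space = vf.span (T ` Basis)" .
  have "vf.independent (T ` Basis)"
    by (rule T.independent_injective_image[OF independent_Basis[unfolded dependent_raw_def]])
      (rule inj_on_subset[OF inj subset_UNIV])
  then have "vf.dim X_space = card (T ` Basis)"
    unfolding sp by (rule vf.dim_span_eq_card_independent)
  also have "\<dots> = card (Basis :: (quat \<times> (real^3) \<times> (real^3)) set)"
    by (rule card_image) (use inj in \<open>auto simp: inj_on_def\<close>)
  also have "\<dots> = 10" by simp
  finally show ?thesis .
qed

lemma X_space_iso: "\<exists>f. lie_isomorphism vf_scale X_space vf_bracket (*\<^sub>R) so14 mat_bracket f"
proof -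
  interpret a: Vector_Spaces.linear "(*\<^sub>R)" vf_scale opposite_field by (rule linear_opposite_field)
  let ?f = "inv_into so14 opposite_field"
  have [simp]: "?f (opposite_field Y) = Y" if "Y \<in> so14" for Y
    using that inj_opposite_field by simp
  note cl = subspace_add[OF subspace_so14] subspace_scale[OF subspace_so14] mat_bracket_so14
  have "bij_betw ?f X_space so14"
    unfolding X_space_eq_opposite_fields by (rule bij_betw_inv_into) (simp add: bij_betw_def
      inj_opposite_field)
  then have "lie_isomorphism vf_scale X_space vf_bracket (*\<^sub>R) so14 mat_bracket ?f"
    unfolding lie_isomorphism_def X_space_eq_opposite_fields
    by (auto simp: vf_bracket_opposite_field cl simp flip: a.add a.scale)
  then show ?thesis by blast
qed

theorem theorem4p4:
  shows "inf_action ` so14 = X_space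
    \<and> lie_algebra vf_scale X_space vf_bracket
    \<and> vf.dim X_space = 10
    \<and> (\<exists>f. lie_isomorphism vf_scale X_space vf_bracket (*\<^sub>R) so14 mat_bracket f)"
  using X_space_eq_action_fields inf_action_eq_action_field X_space_lie_algebra dim_X_space
    X_space_iso by simp

end
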